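(* Let $G=(V,E)$ be an ancestral graph with $n$ nodes, $X,Y\subseteq V$ disjoint and non-empty, $R\subseteq V$ disjoint from $X\cup Y$, and $I\subseteq Z\subseteq V\setminus(X\cup Y)$. Using the following algorithm, the task TestMinSep, both for testing $I$-minimality (decide whether $Z\subseteq R$ is an $I$-minimal $m$-separator relative to $(X,Y)$; parameter $M=I$) and for testing strong-minimality (decide whether $Z\subseteq R$ is a strongly-minimal $m$-separator relative to $(X,Y)$; parameter $M=\emptyset$), can be solved in time $O(m_a)=O(n^2)$, where $m_a$ is the number of edges of the augmented graph $(G_{Ant(X\cup Y\cup I)})^a$. Algorithm TestMinSep$(G,X,Y,Z,M,R)$: 1. If $Z\setminus Ant(X\cup Y\cup M)\neq\emptyset$ or $Z\not\subseteq R$, return false. 2. If TestSep$(G,X,Y,Z)$ returns false, return false. 3. Let $G'^a=(G_{Ant(X\cup Y\cup M)})^a$, and remove from $G'^a$ all nodes of $M$. 4. Let $R_x$ be the set of all $v\in Z$ for which there is a path from $X$ to $v$ in $G'^a$ not intersecting $Z\setminus\{v\}$. If $Z\neq R_x$, return false. 5. Let $R_y$ be the set of all $v\in Z$ for which there is a path from $Y$ to $v$ in $G'^a$ not intersecting $Z\setminus\{v\}$. If $Z\neq R_y$, return false. 6. Return true.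
   Context: A mixed graph has directed ($A\to B$), undirected ($A-B$) and bidirected ($A\leftrightarrow B$) edges. A path is a sequence of distinct nodes with consecutive nodes adjacent; adjacent nodes are neighbors. $U$ is an ancestor of $W$ if there is a directed path $U\to\cdots\to W$; $U$ is an anterior of $W$ if there is a path from $U$ to $W$ that becomes directed after replacing each undirected edge $S-T$ on it (traversed from $S$ to $T$) by $S\to T$. Every node is its own ancestor and anterior; $An(S)$, $Ant(S)$ are the ancestor and anterior sets of $S$. A mixed graph is an ancestral graph if (1) for each edge $A\gets B$ or $A\leftrightarrow B$, $A$ is not an anterior of $B$, and (2) for each edge $A-B$ there are no edges $A\gets C$, $A\leftrightarrow C$, $B\gets C$ or $B\leftrightarrow C$. A node on a path is a collider if two arrowheads of the path meet at it. Nodes $U,W$ are $m$-connected by $Z$ if there is a path between them on which every collider is in $An(Z)$ and every non-collider is not in $Z$; otherwise $Z$ $m$-separates them. $Z$ $m$-separates sets $X,Y$ (is an $m$-separator relative to $(X,Y)$) if it $m$-separates every $U\in X$ from every $W\in Y$. For a node set $M$, an $m$-separator $Z$ relative to $(X,Y)$ is $M$-minimal if $M\subseteq Z$ and no set $Z'\subsetneq Z$ with $M\subseteq Z'$ is an $m$-separator relative to $(X,Y)$. Strongly-minimal means $\emptyset$-minimal. $G_S$ denotes the induced subgraph on $S$. The augmented graph $(H)^a$ of an ancestral graph $H$ is the undirected graph on the same nodes whose edges are all pairs of nodes joined in $H$ by a path all of whose non-endpoint nodes are colliders (in particular all adjacent pairs). TestSep$(G,X,Y,Z)$ is the following procedure,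 which decides whether $Z$ $m$-separates $X$ and $Y$: let $P=\{(\gets,x):x\in X\}$ and $Q=P$. While $P$ is not empty: remove a pair $(e,T)$ from $P$; for every neighbor $N$ of $T$, with $f$ the edge between $T$ and $N$ (type read from $T$ to $N$), if $e,T,f$ is $m$-connecting and $(f,N)\notin Q$, add $(f,N)$ to $P$ and $Q$; then, if $T\in Y$, return false. When $P$ is empty, return true. Here $e$ is an edge type read in the direction in which $T$ is entered, and $e,T,f$ is $m$-connecting if either $T\notin Z$ and $e,f$ do not both have an arrowhead at $T$, or $T\in Z$ and both have an arrowhead at $T$ ($f$ may be the edge through which $T$ was entered).
   Formalization: Steps 4 and 5 compare R_x, R_y with Z∖M instead of Z (literally, every Z is rejected when M≠∅), and the time O(m_a) is stated as O(n+m+m_a), with m the number of edges of G (m_a can be 0 while TestSep scans G); the O(n²) bound is kept. *)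

theory Defs
  imports Main "HOL-Library.Monad_Syntax" "HOL-Library.While_Combinator"
begin

section \<open>Mixed and ancestral graphs\<close>

record 'v mixed_graph =
  nodes :: "'v set"
  dir :: "('v \<times> 'v) set"
  undir :: "('v \<times> 'v) set"
  bidir :: "('v \<times> 'v) set"

text \<open>Undirected and bidirected edges are stored in both orientations. Several edges of different
  kinds between two nodes are allowed in a mixed graph; they cannot occur in an ancestral graph, so
  there a sequence of nodes determines the edges of a path.\<close>

definition mixed_graph :: "'v mixed_graph \<Rightarrow> bool" where
  "mixed_graph G \<longleftrightarrow> finite (nodes G)
     \<and> dir G \<union> undir G \<union> bidir G \<subseteq> nodes G \<times> nodes G
     \<and> irrefl (dir G) \<and> irrefl (undir G) \<and> irrefl (bidir G)
     \<and> sym (undir G) \<and> sym (bidir G)"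

definition adjacent :: "'v mixed_graph \<Rightarrow> 'v \<Rightarrow> 'v \<Rightarrow> bool" where
  "adjacent G u v \<longleftrightarrow> (u, v) \<in> dir G \<or> (v, u) \<in> dir G \<or> (u, v) \<in> undir G \<or> (u, v) \<in> bidir G"

definition edges :: "'v mixed_graph \<Rightarrow> 'v set set" where
  "edges G = {{u, v} |u v. adjacent G u v}"

definition path :: "'v mixed_graph \<Rightarrow> 'v list \<Rightarrow> bool" where
  "path G p \<longleftrightarrow> p \<noteq> [] \<and> distinct p \<and> set p \<subseteq> nodes G \<and> successively (adjacent G) p"

definition ancestor :: "'v mixed_graph \<Rightarrow> 'v \<Rightarrow> 'v \<Rightarrow> bool" where
  "ancestor G u w \<longleftrightarrow> (\<exists>p. path G p \<and> hd p = u \<and> last p = w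
     \<and> successively (\<lambda>s t. (s, t) \<in> dir G) p)"

definition anterior :: "'v mixed_graph \<Rightarrow> 'v \<Rightarrow> 'v \<Rightarrow> bool" where
  "anterior G u w \<longleftrightarrow> (\<exists>p. path G p \<and> hd p = u \<and> last p = w
     \<and> successively (\<lambda>s t. (s, t) \<in> dir G \<or> (s, t) \<in> undir G) p)"

definition An :: "'v mixed_graph \<Rightarrow> 'v set \<Rightarrow> 'v set" where
  "An G S = {u. \<exists>w\<in>S. ancestor G u w}"

definition Ant :: "'v mixed_graph \<Rightarrow> 'v set \<Rightarrow> 'v set" where
  "Ant G S = {u. \<exists>w\<in>S. anterior G u w}"

definition ancestral_graph :: "'v mixed_graph \<Rightarrow> bool" where
  "ancestral_graph G \<longleftrightarrow> mixed_graph G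
     \<and> (\<forall>a b. (b, a) \<in> dir G \<or> (a, b) \<in> bidir G \<longrightarrow> \<not> anterior G a b)
     \<and> (\<forall>a b c. (a, b) \<in> undir G \<longrightarrow>
          (c, a) \<notin> dir G \<and> (a, c) \<notin> bidir G \<and> (c, b) \<notin> dir G \<and> (b, c) \<notin> bidir G)"

section \<open>Separation\<close>

definition arrowhead :: "'v mixed_graph \<Rightarrow> 'v \<Rightarrow> 'v \<Rightarrow> bool" where
  "arrowhead G u v \<longleftrightarrow> (u, v) \<in> dir G \<or> (u, v) \<in> bidir G"

definition collider :: "'v mixed_graph \<Rightarrow> 'v list \<Rightarrow> nat \<Rightarrow> bool" where
  "collider G p i \<longleftrightarrow> 0 < i \<and> Suc i < length p
     \<and> arrowhead G (p ! (i - 1)) (p ! i) \<and> arrowhead G (p ! Suc i) (p ! i)"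

definition m_connected :: "'v mixed_graph \<Rightarrow> 'v set \<Rightarrow> 'v \<Rightarrow> 'v \<Rightarrow> bool" where
  "m_connected G Z u w \<longleftrightarrow> (\<exists>p. path G p \<and> hd p = u \<and> last p = w
     \<and> (\<forall>i<length p. if collider G p i then p ! i \<in> An G Z else p ! i \<notin> Z))"

definition m_separator :: "'v mixed_graph \<Rightarrow> 'v set \<Rightarrow> 'v set \<Rightarrow> 'v set \<Rightarrow> bool" where
  "m_separator G X Y Z \<longleftrightarrow> (\<forall>u\<in>X. \<forall>w\<in>Y. \<not> m_connected G Z u w)"

definition minimal_m_separator ::
    "'v mixed_graph \<Rightarrow> 'v set \<Rightarrow> 'v set \<Rightarrow> 'v set \<Rightarrow> 'v set \<Rightarrow> bool" where
  "minimal_m_separator G M X Y Z \<longleftrightarrow> M \<subseteq> Z \<and> m_separator G X Y Z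
     \<and> \<not> (\<exists>Z'. Z' \<subset> Z \<and> M \<subseteq> Z' \<and> m_separator G X Y Z')"

abbreviation strongly_minimal_m_separator ::
    "'v mixed_graph \<Rightarrow> 'v set \<Rightarrow> 'v set \<Rightarrow> 'v set \<Rightarrow> bool" where
  "strongly_minimal_m_separator G X Y Z \<equiv> minimal_m_separator G {} X Y Z"

section \<open>Induced subgraphs and augmented graphs\<close>

definition induced :: "'v mixed_graph \<Rightarrow> 'v set \<Rightarrow> 'v mixed_graph" where
  "induced G S = \<lparr>nodes = nodes G \<inter> S, dir = dir G \<inter> S \<times> S,
     undir = undir G \<inter> S \<times> S, bidir = bidir G \<inter> S \<times> S\<rparr>"

type_synonym 'v ugraph = "'v set \<times> 'v set set"

definition augmented :: "'v mixed_graph \<Rightarrow> 'v ugraph" where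
  "augmented H = (nodes H,
     {{u, v} |u v. u \<noteq> v \<and> (\<exists>p. path H p \<and> hd p = u \<and> last p = v
        \<and> (\<forall>i. 0 < i \<and> Suc i < length p \<longrightarrow> collider H p i))})"

definition delete_nodes :: "'v set \<Rightarrow> 'v ugraph \<Rightarrow> 'v ugraph" where
  "delete_nodes M H = (fst H - M, {e \<in> snd H. e \<inter> M = {}})"

definition upath :: "'v ugraph \<Rightarrow> 'v list \<Rightarrow> bool" where
  "upath H p \<longleftrightarrow> p \<noteq> [] \<and> distinct p \<and> set p \<subseteq> fst H
     \<and> successively (\<lambda>u v. {u, v} \<in> snd H) p"

section \<open>The algorithm\<close>

text \<open>An edge type \<open>e\<close> is read in a direction: \<open>joins G u e v\<close> says that \<open>u\<close> and \<open>v\<close> are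
  joined by an edge which, read from \<open>u\<close> to \<open>v\<close>, is \<open>\<rightarrow>\<close>, \<open>\<leftarrow>\<close>, \<open>-\<close> or \<open>\<leftrightarrow>\<close>, respectively.\<close>

datatype edge_type = Right | Left | Undirected | Bidirected

fun joins :: "'v mixed_graph \<Rightarrow> 'v \<Rightarrow> edge_type \<Rightarrow> 'v \<Rightarrow> bool" where
  "joins G u Right v \<longleftrightarrow> (u, v) \<in> dir G"
| "joins G u Left v \<longleftrightarrow> (v, u) \<in> dir G"
| "joins G u Undirected v \<longleftrightarrow> (u, v) \<in> undir G"
| "joins G u Bidirected v \<longleftrightarrow> (u, v) \<in> bidir G"

definition head_at_start :: "edge_type \<Rightarrow> bool" where
  "head_at_start e \<longleftrightarrow> e = Left \<or> e = Bidirected"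

definition head_at_end :: "edge_type \<Rightarrow> bool" where
  "head_at_end e \<longleftrightarrow> e = Right \<or> e = Bidirected"

definition m_connecting :: "'v set \<Rightarrow> edge_type \<Rightarrow> 'v \<Rightarrow> edge_type \<Rightarrow> bool" where
  "m_connecting Z e T f \<longleftrightarrow> T \<notin> Z \<and> \<not> (head_at_end e \<and> head_at_start f)
                          \<or> T \<in> Z \<and> head_at_end e \<and> head_at_start f"

text \<open>\<open>test_sep_loop G Y Z P Q b\<close>: from the sets \<open>P\<close> and \<open>Q\<close> the loop of TestSep can return \<open>b\<close>.
  It is a relation because the pair removed from \<open>P\<close> is not prescribed.\<close>

inductive test_sep_loop ::
    "'v mixed_graph \<Rightarrow> 'v set \<Rightarrow> 'v set \<Rightarrow> (edge_type \<times> 'v) set \<Rightarrow> (edge_type \<times> 'v) set \<Rightarrow> bool \<Rightarrow> bool"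
  for G Y Z where
  "test_sep_loop G Y Z {} Q True"
| "(e, T) \<in> P \<Longrightarrow> T \<in> Y \<Longrightarrow> test_sep_loop G Y Z P Q False"
| "(e, T) \<in> P \<Longrightarrow> T \<notin> Y \<Longrightarrow>
   New = {(f, N). joins G T f N \<and> m_connecting Z e T f \<and> (f, N) \<notin> Q} \<Longrightarrow>
   test_sep_loop G Y Z (P - {(e, T)} \<union> New) (Q \<union> New) b \<Longrightarrow> test_sep_loop G Y Z P Q b"

definition test_sep :: "'v mixed_graph \<Rightarrow> 'v set \<Rightarrow> 'v set \<Rightarrow> 'v set \<Rightarrow> bool \<Rightarrow> bool" where
  "test_sep G X Y Z b \<longleftrightarrow> (let P = {(Left, x) |x. x \<in> X} in test_sep_loop G Y Z P P b)"

definition reached :: "'v ugraph \<Rightarrow> 'v set \<Rightarrow> 'v set \<Rightarrow> 'v set" where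
  "reached H S Z = {v \<in> Z. \<exists>p. upath H p \<and> hd p \<in> S \<and> last p = v \<and> set p \<inter> (Z - {v}) = {}}"

text \<open>\<open>test_min_sep G X Y Z M R b\<close>: TestMinSep can return \<open>b\<close>. Removing \<open>M\<close> from the augmented
  graph also removes it from \<open>Z\<close>: no node of \<open>M\<close> can be reached afterwards, so the sets of reached
  nodes are compared with \<open>Z - M\<close>. Comparing them with \<open>Z\<close> would reject every \<open>Z\<close> if \<open>M \<noteq> {}\<close>.\<close>

definition test_min_sep ::
    "'v mixed_graph \<Rightarrow> 'v set \<Rightarrow> 'v set \<Rightarrow> 'v set \<Rightarrow> 'v set \<Rightarrow> 'v set \<Rightarrow> bool \<Rightarrow> bool" where
  "test_min_sep G X Y Z M R b \<longleftrightarrow>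
     (if Z - Ant G (X \<union> Y \<union> M) \<noteq> {} \<or> \<not> Z \<subseteq> R then b = False
      else \<exists>s. test_sep G X Y Z s \<and>
        (if s = False then b = False
         else let H = delete_nodes M (augmented (induced G (Ant G (X \<union> Y \<union> M)))) in
           if Z - M \<noteq> reached H X Z then b = False
           else if Z - M \<noteq> reached H Y Z then b = False
           else b = True))"

section \<open>Cost model\<close>

text \<open>A timed computation diverges or yields a result after a number of elementary steps. The
  programs below are built from \<open>tick\<close> (one step), sequential composition and the two loops.
  The value inside a \<open>tick\<close> and the tests of \<open>if\<close> and \<open>while\<close> use only constantly many unit-cost
  operations of a random access machine on nodes, edge types, Booleans and lists (inspecting or
  adding the head), where

  \<^item> a value of type \<open>'v set\<close> is a bit array indexed by the nodes (similarly for sets of pairs of an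
    edge type and a node, and for sets of search states): membership tests and \<open>insert\<close> are
    unit-cost, no other set operation is used, and an array is never used again in the state it
    had before an \<open>insert\<close>;
  \<^item> \<open>adj\<close> is the array of adjacency lists, so looking up \<open>adj v\<close> has unit cost.

  Every \<open>{}\<close> that serves as a cleared array is accompanied by a loop over all nodes, which accounts
  for clearing it.\<close>

datatype 'a timed = Diverges | Result 'a nat

definition tick :: "'a \<Rightarrow> 'a timed" where
  "tick x = Result x 1"

fun bind_timed :: "'a timed \<Rightarrow> ('a \<Rightarrow> 'b timed) \<Rightarrow> 'b timed" where
  "bind_timed Diverges f = Diverges"
| "bind_timed (Result x s) f =
     (case f x of Diverges \<Rightarrow> Diverges | Result y t \<Rightarrow> Result y (s + t))"

adhoc_overloading Monad_Syntax.bind \<rightleftharpoons> bind_timed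

primrec foreach :: "'a list \<Rightarrow> ('a \<Rightarrow> 's \<Rightarrow> 's timed) \<Rightarrow> 's \<Rightarrow> 's timed" where
  "foreach [] f s = tick s"
| "foreach (x # xs) f s = do { s \<leftarrow> tick s; s \<leftarrow> f x s; foreach xs f s }"

text \<open>The state of the underlying iteration is the timed computation so far; thus costs accumulate.\<close>

definition while_timed :: "('s \<Rightarrow> bool) \<Rightarrow> ('s \<Rightarrow> 's timed) \<Rightarrow> 's \<Rightarrow> 's timed" where
  "while_timed b c s =
     (case while_option (\<lambda>r. case r of Diverges \<Rightarrow> False | Result s t \<Rightarrow> b s)
             (\<lambda>r. do { s \<leftarrow> r; s \<leftarrow> tick s; c s }) (tick s) of
        None \<Rightarrow> Diverges | Some r \<Rightarrow> r)"

section \<open>The algorithm as a program\<close>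

definition adjacency_lists ::
    "'v mixed_graph \<Rightarrow> 'v list \<Rightarrow> ('v \<Rightarrow> (edge_type \<times> 'v) list) \<Rightarrow> bool" where
  "adjacency_lists G vs adj \<longleftrightarrow> distinct vs \<and> set vs = nodes G
     \<and> (\<forall>u\<in>nodes G. distinct (adj u) \<and> set (adj u) = {(e, v). joins G u e v})"

definition initial :: "'v list \<Rightarrow> ('v \<Rightarrow> bool) \<Rightarrow> ('v \<Rightarrow> 's) \<Rightarrow> ('s list \<times> 's set) timed" where
  "initial vs S h = foreach vs
     (\<lambda>v (P, Q). tick (if S v then (h v # P, insert (h v) Q) else (P, Q))) ([], {})"

definition add_new :: "'s list \<Rightarrow> 's list \<times> 's set \<Rightarrow> ('s list \<times> 's set) timed" where
  "add_new ss = foreach ss (\<lambda>s (P, Q). tick (if s \<in> Q then (P, Q) else (s # P, insert s Q)))"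

definition search :: "('s \<Rightarrow> 's list timed) \<Rightarrow> 's list \<times> 's set \<Rightarrow> 's set timed" where
  "search succs PQ = do {
     (P, Q) \<leftarrow> while_timed (\<lambda>(P, Q). P \<noteq> [])
       (\<lambda>(P, Q). do { ss \<leftarrow> succs (hd P); add_new ss (tl P, Q) }) PQ;
     tick Q }"

definition anteriors_prog ::
    "'v list \<Rightarrow> ('v \<Rightarrow> (edge_type \<times> 'v) list) \<Rightarrow> ('v \<Rightarrow> bool) \<Rightarrow> 'v set timed" where
  "anteriors_prog vs adj S = do {
     PQ \<leftarrow> initial vs S (\<lambda>v. v);
     search (\<lambda>v. foreach (adj v)
       (\<lambda>(e, w) ws. tick (if e = Left \<or> e = Undirected then w # ws else ws)) []) PQ }"

definition test_sep_prog ::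
    "'v list \<Rightarrow> ('v \<Rightarrow> (edge_type \<times> 'v) list) \<Rightarrow> 'v set \<Rightarrow> 'v set \<Rightarrow> 'v set \<Rightarrow> bool timed" where
  "test_sep_prog vs adj X Y Z = do {
     (P, Q) \<leftarrow> initial vs (\<lambda>x. x \<in> X) (\<lambda>x. (Left, x));
     (P, Q, res) \<leftarrow> while_timed (\<lambda>(P, Q, res). P \<noteq> [] \<and> res)
       (\<lambda>(P, Q, res). case hd P of (e, T) \<Rightarrow> do {
          (P, Q) \<leftarrow> foreach (adj T) (\<lambda>(f, N) (P, Q). tick
            (if m_connecting Z e T f \<and> (f, N) \<notin> Q then ((f, N) # P, insert (f, N) Q) else (P, Q)))
            (tl P, Q);
          tick (P, Q, T \<notin> Y) })
       (P, Q, True);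
     tick res }"

text \<open>A search in the augmented graph \<open>(G\<^sub>A)\<^sup>a\<close> without the nodes of \<open>M\<close>. The edges of \<open>(G\<^sub>A)\<^sup>a\<close> are not
  listed explicitly (for a bipartite DAG this would be a Boolean matrix product); instead the
  paths of colliders they stand for are followed in \<open>G\<^sub>A\<close>: \<open>At v\<close> means that the node \<open>v\<close> of the
  augmented graph is reached, \<open>Via c\<close> that \<open>c\<close> is entered through an arrowhead and has to be left
  as a collider. Nodes of \<open>M\<close> remain available as colliders, since \<open>M\<close> is removed only after the
  augmentation.\<close>

datatype 'v search_state = At 'v | Via 'v

definition aug_succs ::
    "('v \<Rightarrow> (edge_type \<times> 'v) list) \<Rightarrow> 'v set \<Rightarrow> 'v set \<Rightarrow> 'v set \<Rightarrow>
     'v search_state \<Rightarrow> 'v search_state list timed" where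
  "aug_succs adj A Z M s = (case s of
     At v \<Rightarrow>
       if v \<in> Z then tick []
       else foreach (adj v) (\<lambda>(f, w) ss. tick
         ((if w \<in> A \<and> w \<notin> M then [At w] else []) @
          (if w \<in> A \<and> head_at_end f then [Via w] else []) @ ss)) []
   | Via c \<Rightarrow>
       foreach (adj c) (\<lambda>(f, w) ss. tick
         ((if w \<in> A \<and> head_at_start f \<and> w \<notin> M then [At w] else []) @
          (if w \<in> A \<and> f = Bidirected then [Via w] else []) @ ss)) [])"

text \<open>Decides whether \<open>Z - M\<close> consists of the nodes of \<open>Z\<close> reached from \<open>S\<close>.\<close>

definition all_reached_prog ::
    "'v list \<Rightarrow> ('v \<Rightarrow> (edge_type \<times> 'v) list) \<Rightarrow> 'v set \<Rightarrow> 'v set \<Rightarrow> 'v set \<Rightarrow> 'v set \<Rightarrow> bool timed" where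
  "all_reached_prog vs adj A S Z M = do {
     PQ \<leftarrow> initial vs (\<lambda>v. v \<in> S) At;
     Q \<leftarrow> search (aug_succs adj A Z M) PQ;
     foreach vs (\<lambda>v b. tick (b \<and> ((v \<in> Z \<and> v \<notin> M) = (v \<in> Z \<and> At v \<in> Q)))) True }"

definition test_min_sep_prog ::
    "'v list \<Rightarrow> ('v \<Rightarrow> (edge_type \<times> 'v) list) \<Rightarrow>
     'v set \<Rightarrow> 'v set \<Rightarrow> 'v set \<Rightarrow> 'v set \<Rightarrow> 'v set \<Rightarrow> bool timed" where
  "test_min_sep_prog vs adj X Y Z M R = do {
     A \<leftarrow> anteriors_prog vs adj (\<lambda>v. v \<in> X \<or> v \<in> Y \<or> v \<in> M);
     ok \<leftarrow> foreach vs (\<lambda>v b. tick (b \<and> (v \<in> Z \<longrightarrow> v \<in> A \<and> v \<in> R))) True;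
     if \<not> ok then tick False
     else do {
       sep \<leftarrow> test_sep_prog vs adj X Y Z;
       if \<not> sep then tick False
       else do {
         okx \<leftarrow> all_reached_prog vs adj A X Z M;
         if \<not> okx then tick False
         else all_reached_prog vs adj A Y Z M } } }"

end

theory Submission
  imports Defs
begin

text \<open>For \<open>M \<subseteq> Z \<subseteq> Ant (X \<union> Y \<union> M)\<close> all sets between \<open>M\<close> and \<open>Z\<close> have the same anterior set
  together with \<open>X \<union> Y\<close>, so their separation property is tested in one and the same undirected graph,
  the augmented graph of that anterior set. There separators are closed under supersets, hence \<open>Z\<close> is
  minimal iff no single node of \<open>Z - M\<close> can be dropped, i.e. iff each such node is reached both from
  \<open>X\<close> and from \<open>Y\<close> without meeting the rest of \<open>Z\<close>. Minimality forces \<open>Z\<close> into the anterior set because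
  a path connecting \<open>X\<close> and \<open>Y\<close> given the remaining nodes never leaves it.

  All searches run over at most four states per node, and a state costs as much as the degree of its
  node. As a path of colliders is followed edge by edge instead of listing the edges of the
  augmented graph, the running time is even linear in the size of \<open>G\<close>.\<close>

section \<open>Walks in ancestral graphs\<close>

text \<open>m-connection speaks of paths with distinct nodes, whereas TestSep and the search in the
  augmented graph follow sequences that may revisit nodes and turn back on an edge. Hence everything
  is compared with walks whose set of admissible colliders is a parameter: \<open>An G Z\<close>
  gives m-connection, \<open>Z\<close> gives TestSep, and the anterior set gives the augmented
  graph. For walks from \<open>X\<close> to \<open>Y\<close> the three agree, since a collider
  admissible only for a larger set can be avoided along directed walks. This uses the ancestral
  conditions: an arrowhead at a node excludes undirected edges there, so such a node is an anterior
  of a set only if it is an ancestor of it. The conditions also allow loops to be cut out of a walk.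
  Deleting \<open>M\<close> and blocking at \<open>Z\<close> are expressed by one asymmetric step
  relation, in which nodes of \<open>Z\<close> may be entered but not left and nodes of
  \<open>M\<close> may not be entered.\<close>

lemma rtranclp_distinct_path:
  assumes "r\<^sup>*\<^sup>* x y"
  shows "\<exists>p. p \<noteq> [] \<and> distinct p \<and> successively r p \<and> hd p = x \<and> last p = y"
  using assms
proof (induction rule: converse_rtranclp_induct)
  case base
  show ?case by (rule exI[of _ "[y]"]) simp
next
  case (step x z)
  then obtain p where p: "p \<noteq> []" "distinct p" "successively r p" "hd p = z" "last p = y" by blast
  show ?case
  proof (cases "x \<in> set p")
    case True
    then obtain q q' where "p = q @ x # q'" by (meson split_list)
    with p show ?thesis by (intro exI[of _ "x # q'"]) (auto simp: successively_append_iff)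
  next
    case False
    with p step.hyps show ?thesis
      by (intro exI[of _ "x # p"]) (cases p, auto)
  qed
qed

lemma successively_imp_rtranclp:
  assumes "p \<noteq> []" "successively r p"
  shows "r\<^sup>*\<^sup>* (hd p) (last p)"
  using assms
proof (induction p rule: induct_list012)
  case (3 x y zs)
  then show ?case by (auto intro: converse_rtranclp_into_rtranclp)
qed auto

lemma successively_subset:
  assumes "p \<noteq> []" "successively r p" "hd p \<in> N" "\<And>s t. r s t \<Longrightarrow> t \<in> N"
  shows "set p \<subseteq> N"
  using assms
proof (induction p rule: induct_list012)
  case (3 x y zs)
  then show ?case by (auto dest: 3(6))
qed auto

text \<open>Cutting loops makes the distinctness of a path free, so ancestors and anteriors become
  reflexive transitive closures.\<close>

lemma path_iff_rtranclp:
  assumes "\<And>s t. r s t \<Longrightarrow> adjacent G s t" "\<And>s t. adjacent G s t \<Longrightarrow> t \<in> nodes G"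
  shows "(\<exists>p. path G p \<and> hd p = u \<and> last p = w \<and> successively r p) \<longleftrightarrow> u \<in> nodes G \<and> r\<^sup>*\<^sup>* u w"
proof
  assume "\<exists>p. path G p \<and> hd p = u \<and> last p = w \<and> successively r p"
  then show "u \<in> nodes G \<and> r\<^sup>*\<^sup>* u w"
    by (auto simp: path_def successively_imp_rtranclp)
next
  assume *: "u \<in> nodes G \<and> r\<^sup>*\<^sup>* u w"
  then obtain p where p: "p \<noteq> []" "distinct p" "successively r p" "hd p = u" "last p = w"
    using rtranclp_distinct_path by metis
  have "set p \<subseteq> nodes G"
    using successively_subset[OF p(1,3)] p(4) * assms by blast
  with p have "path G p"
    unfolding path_def using assms(1) by (metis successively_mono)
  with p show "\<exists>p. path G p \<and> hd p = u \<and> last p = w \<and> successively r p" by blast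
qed

section \<open>Adjacency, ancestors and anteriors in mixed graphs\<close>

lemma adjacent_nodes:
  assumes "mixed_graph G" "adjacent G u v"
  shows "u \<in> nodes G" "v \<in> nodes G"
  using assms unfolding mixed_graph_def adjacent_def by blast+

lemma adjacent_sym: "mixed_graph G \<Longrightarrow> adjacent G u v \<longleftrightarrow> adjacent G v u"
  by (auto simp: mixed_graph_def adjacent_def sym_def)

lemma adjacent_irrefl: "mixed_graph G \<Longrightarrow> \<not> adjacent G u u"
  by (auto simp: mixed_graph_def adjacent_def irrefl_def)

lemma arrowhead_adjacent: "mixed_graph G \<Longrightarrow> arrowhead G u v \<Longrightarrow> adjacent G u v"
  by (auto simp: mixed_graph_def adjacent_def arrowhead_def sym_def)

lemma bidir_sym: "mixed_graph G \<Longrightarrow> (u, v) \<in> bidir G \<longleftrightarrow> (v, u) \<in> bidir G"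
  by (auto simp: mixed_graph_def sym_def)

lemma undir_sym: "mixed_graph G \<Longrightarrow> (u, v) \<in> undir G \<longleftrightarrow> (v, u) \<in> undir G"
  by (auto simp: mixed_graph_def sym_def)

lemma ancestor_iff:
  assumes "mixed_graph G"
  shows "ancestor G u w \<longleftrightarrow> u \<in> nodes G \<and> (u, w) \<in> (dir G)\<^sup>*"
proof -
  have "ancestor G u w \<longleftrightarrow> u \<in> nodes G \<and> (\<lambda>s t. (s, t) \<in> dir G)\<^sup>*\<^sup>* u w"
    unfolding ancestor_def
    by (rule path_iff_rtranclp[OF _ adjacent_nodes(2)[OF assms]]) (auto simp: adjacent_def)
  then show ?thesis by (simp add: rtranclp_rtrancl_eq)
qed

lemma anterior_iff:
  assumes "mixed_graph G"
  shows "anterior G u w \<longleftrightarrow> u \<in> nodes G \<and> (u, w) \<in> (dir G \<union> undir G)\<^sup>*"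
proof -
  have "anterior G u w \<longleftrightarrow> u \<in> nodes G \<and> (\<lambda>s t. (s, t) \<in> dir G \<or> (s, t) \<in> undir G)\<^sup>*\<^sup>* u w"
    unfolding anterior_def
    by (rule path_iff_rtranclp[OF _ adjacent_nodes(2)[OF assms]]) (auto simp: adjacent_def)
  moreover have "{(s, t). (s, t) \<in> dir G \<or> (s, t) \<in> undir G} = dir G \<union> undir G" by auto
  ultimately show ?thesis by (simp add: rtranclp_rtrancl_eq)
qed

lemma An_iff: "mixed_graph G \<Longrightarrow> u \<in> An G S \<longleftrightarrow> u \<in> nodes G \<and> (\<exists>w\<in>S. (u, w) \<in> (dir G)\<^sup>*)"
  by (auto simp: An_def ancestor_iff)

lemma Ant_iff:
  "mixed_graph G \<Longrightarrow> u \<in> Ant G S \<longleftrightarrow> u \<in> nodes G \<and> (\<exists>w\<in>S. (u, w) \<in> (dir G \<union> undir G)\<^sup>*)"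
  by (auto simp: Ant_def anterior_iff)

lemma An_parent: "mixed_graph G \<Longrightarrow> (a, b) \<in> dir G \<Longrightarrow> b \<in> An G S \<Longrightarrow> a \<in> An G S"
  by (auto simp: An_iff mixed_graph_def intro: converse_rtrancl_into_rtrancl)

lemma Ant_mono: "S \<subseteq> T \<Longrightarrow> Ant G S \<subseteq> Ant G T"
  by (auto simp: Ant_def)

lemma An_mono: "S \<subseteq> T \<Longrightarrow> An G S \<subseteq> An G T"
  by (auto simp: An_def)

lemma subset_Ant: "mixed_graph G \<Longrightarrow> S \<subseteq> nodes G \<Longrightarrow> S \<subseteq> Ant G S"
  by (auto simp: Ant_iff)

lemma Ant_Ant: "mixed_graph G \<Longrightarrow> Ant G (Ant G S) \<subseteq> Ant G S"
  by (auto simp: Ant_iff) (meson rtrancl_trans)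

lemma An_subset_Ant: "mixed_graph G \<Longrightarrow> An G S \<subseteq> Ant G S"
  by (auto simp: Ant_iff An_iff) (meson in_rtrancl_UnI)

lemma Ant_subset_nodes: "mixed_graph G \<Longrightarrow> Ant G S \<subseteq> nodes G"
  by (auto simp: Ant_iff)

text \<open>\<open>walk_to G Z C S h v\<close>: some walk from \<open>S\<close> to \<open>v\<close>, whose last edge has an arrowhead at \<open>v\<close>
  iff \<open>h\<close>, has all its colliders in \<open>C\<close> and all its other nodes but \<open>v\<close> outside \<open>Z\<close>.
  Since an ancestral graph has at most one edge between two nodes, \<open>h\<close> is all that matters
  for continuing the walk.\<close>

inductive walk_to ::
    "'v mixed_graph \<Rightarrow> 'v set \<Rightarrow> 'v set \<Rightarrow> 'v set \<Rightarrow> bool \<Rightarrow> 'v \<Rightarrow> bool"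
  for G Z C S where
  start: "x \<in> S \<Longrightarrow> walk_to G Z C S False x"
| step: "walk_to G Z C S h v \<Longrightarrow> adjacent G v w \<Longrightarrow>
    (if h \<and> arrowhead G w v then v \<in> C else v \<notin> Z) \<Longrightarrow> walk_to G Z C S (arrowhead G v w) w"

text \<open>The last node is exempt, unlike in \<open>m_connected\<close>: prefixes of open paths
  are then open, and a node is constrained only when the path is continued, as in
  \<open>walk_to\<close>.\<close>

definition open_path :: "'v mixed_graph \<Rightarrow> 'v set \<Rightarrow> 'v set \<Rightarrow> 'v list \<Rightarrow> bool" where
  "open_path G Z C p \<longleftrightarrow> path G p \<and>
     (\<forall>i. Suc i < length p \<longrightarrow> (if collider G p i then p ! i \<in> C else p ! i \<notin> Z))"

section \<open>Edge marks, open walks and open paths in an ancestral graph\<close>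

context
  fixes G :: "'v mixed_graph"
  assumes G: "ancestral_graph G"
begin

lemma ancestral_imp_mixed: "mixed_graph G"
  using G by (simp add: ancestral_graph_def)

lemma arrowhead_not_undir: "arrowhead G u v \<Longrightarrow> (v, w) \<notin> undir G"
  using G bidir_sym[OF ancestral_imp_mixed] unfolding ancestral_graph_def arrowhead_def by blast

lemma dir_not_arrowhead: "(u, v) \<in> dir G \<Longrightarrow> \<not> arrowhead G v u"
proof
  assume uv: "(u, v) \<in> dir G" and vu: "arrowhead G v u"
  have "u \<in> nodes G" using uv ancestral_imp_mixed by (auto simp: mixed_graph_def)
  with uv have "anterior G u v" by (auto simp: anterior_iff[OF ancestral_imp_mixed])
  moreover have "(v, u) \<in> dir G \<or> (u, v) \<in> bidir G" using vu bidir_sym[OF ancestral_imp_mixed] by (auto simp: arrowhead_def)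
  ultimately show False using G by (auto simp: ancestral_graph_def)
qed

lemma adjacent_no_arrowhead:
  "adjacent G u v \<Longrightarrow> \<not> arrowhead G v u \<Longrightarrow> (u, v) \<in> dir G \<or> (u, v) \<in> undir G"
  using bidir_sym[OF ancestral_imp_mixed] by (auto simp: adjacent_def arrowhead_def)

text \<open>The tail at \<open>u\<close> leaves only a directed or an undirected edge, and the
  arrowhead at \<open>u\<close> rules out the undirected one.\<close>

lemma tail_after_arrowhead:
  "arrowhead G t u \<Longrightarrow> adjacent G u v \<Longrightarrow> \<not> arrowhead G v u \<Longrightarrow> (u, v) \<in> dir G"
  using adjacent_no_arrowhead arrowhead_not_undir by blast

lemma both_arrowheads: "arrowhead G u v \<Longrightarrow> arrowhead G v u \<Longrightarrow> (u, v) \<in> bidir G"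
  using dir_not_arrowhead by (auto simp: arrowhead_def)

text \<open>Two nodes are joined by at most one edge, so the marks stored in an edge type and those
  seen by \<open>arrowhead\<close> cannot come from different edges.\<close>

lemma joins_head:
  assumes "joins G u f v"
  shows "head_at_end f \<longleftrightarrow> arrowhead G u v" "head_at_start f \<longleftrightarrow> arrowhead G v u"
  using assms dir_not_arrowhead arrowhead_not_undir bidir_sym[OF ancestral_imp_mixed] undir_sym[OF ancestral_imp_mixed]
  by (cases f; fastforce simp: head_at_end_def head_at_start_def arrowhead_def)+

lemma adjacent_iff_joins: "adjacent G u v \<longleftrightarrow> (\<exists>f. joins G u f v)"
proof
  assume "adjacent G u v"
  then show "\<exists>f. joins G u f v"
    unfolding adjacent_def by (metis joins.simps)
next
  assume "\<exists>f. joins G u f v"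
  then obtain f where "joins G u f v" ..
  then show "adjacent G u v" by (cases f) (auto simp: adjacent_def)
qed

text \<open>An undirected edge cannot leave a node with an arrowhead, so a nontrivial anterior walk
  starts with a directed edge; this puts an arrowhead at the next node, and the argument
  repeats.\<close>

lemma Ant_arrowhead_An:
  assumes "arrowhead G t v" "v \<in> Ant G S"
  shows "v \<in> An G S"
proof -
  obtain w where w: "w \<in> S" "(v, w) \<in> (dir G \<union> undir G)\<^sup>*" and v: "v \<in> nodes G"
    using assms by (auto simp: Ant_iff[OF ancestral_imp_mixed])
  have "\<forall>t. arrowhead G t v \<longrightarrow> (v, w) \<in> (dir G)\<^sup>*"
    using w(2)
  proof (induction rule: converse_rtrancl_induct)
    case (step a b)
    then show ?case
      using arrowhead_not_undir
      by (metis Un_iff arrowhead_def converse_rtrancl_into_rtrancl)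
  qed simp
  with assms w v show ?thesis by (auto simp: An_iff[OF ancestral_imp_mixed])
qed

lemma open_path_take:
  "open_path G Z C p \<Longrightarrow> i < length p \<Longrightarrow> open_path G Z C (take (Suc i) p)"
proof -
  assume p: "open_path G Z C p" and i: "i < length p"
  have "successively (adjacent G) (take (Suc i) p)"
    using p append_take_drop_id[of "Suc i" p]
    unfolding open_path_def path_def by (metis successively_append_iff)
  then have "path G (take (Suc i) p)"
    using p i set_take_subset[of "Suc i" p] by (auto simp: open_path_def path_def)
  moreover have "collider G (take (Suc i) p) j \<longleftrightarrow> collider G p j" if "j < i" for j
    using that i by (auto simp: collider_def)
  ultimately show ?thesis
    using p i by (auto simp: open_path_def)
qed

lemma path_nth_adjacent: "path G p \<Longrightarrow> Suc i < length p \<Longrightarrow> adjacent G (p ! i) (p ! Suc i)"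
  by (simp add: path_def successively_conv_nth)

text \<open>A node outside \<open>C\<close> entered through an arrowhead is no collider, so it is
  left by a tail, hence along a directed edge. The next node is again entered through an arrowhead
  and again outside \<open>C\<close>, since \<open>C\<close> is closed under parents.\<close>

lemma directed_until_collider:
  assumes p: "open_path G Z C p" and C: "\<And>a b. (a, b) \<in> dir G \<Longrightarrow> b \<in> C \<Longrightarrow> a \<in> C"
    and i: "0 < i" "arrowhead G (p ! (i - 1)) (p ! i)" "p ! i \<notin> C"
    and j: "i \<le> j" "j < length p"
  shows "(p ! i, p ! j) \<in> (dir G)\<^sup>* \<and> arrowhead G (p ! (j - 1)) (p ! j)"
  using j
proof (induction j rule: dec_induct)
  case base
  then show ?case using i by simp
next
  case (step j)
  then have IH: "(p ! i, p ! j) \<in> (dir G)\<^sup>*" "arrowhead G (p ! (j - 1)) (p ! j)" by auto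
  have "p ! j \<notin> C"
  proof
    have "a \<in> C" if "(a, b) \<in> (dir G)\<^sup>*" "b \<in> C" for a b
      using that by (induction rule: converse_rtrancl_induct) (auto intro: C)
    moreover assume "p ! j \<in> C"
    ultimately show False using IH i by blast
  qed
  with p step.prems have "\<not> collider G p j" by (auto simp: open_path_def)
  then have "\<not> arrowhead G (p ! Suc j) (p ! j)"
    using IH(2) step.hyps step.prems i(1) by (auto simp: collider_def)
  moreover have "adjacent G (p ! j) (p ! Suc j)"
    using p step.prems by (auto simp: open_path_def intro: path_nth_adjacent)
  ultimately have "(p ! j, p ! Suc j) \<in> dir G"
    using IH(2) tail_after_arrowhead by blast
  with IH show ?case by (auto simp: arrowhead_def)
qed

text \<open>Loops are cut out of a walk. If the loop at \<open>w\<close> is entered or left with a tail at \<open>w\<close>, the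
  cut may turn \<open>w\<close> into a collider; then a directed walk from \<open>w\<close> leads to a collider on the loop.\<close>

lemma walk_to_imp_open_path:
  assumes C: "\<And>a b. (a, b) \<in> dir G \<Longrightarrow> b \<in> C \<Longrightarrow> a \<in> C"
    and S: "S \<subseteq> nodes G"
    and "walk_to G Z C S h v"
  shows "\<exists>p. open_path G Z C p \<and> hd p \<in> S \<and> last p = v"
proof -
  define ah where "ah p = (1 < length p \<and> arrowhead G (p ! (length p - 2)) (last p))" for p
  \<comment> \<open>The shortened path may arrive at \<open>v\<close> with a mark different from
    that of the walk. The last two conjuncts repair this: a lost arrowhead may turn \<open>v\<close>
    into a non-collider, a gained one into a collider.\<close>
  have "\<exists>p. open_path G Z C p \<and> hd p \<in> S \<and> last p = v \<and>
      (h \<and> \<not> ah p \<longrightarrow> v \<notin> Z) \<and> (\<not> h \<and> ah p \<longrightarrow> v \<in> C)"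
    using assms(3)
  proof (induction rule: walk_to.induct)
    case (start x)
    then show ?case using S
      by (intro exI[of _ "[x]"]) (auto simp: open_path_def path_def ah_def)
  next
    case (step h v w)
    then obtain p where p: "open_path G Z C p" "hd p \<in> S" "last p = v"
      "h \<and> \<not> ah p \<Longrightarrow> v \<notin> Z" "\<not> h \<and> ah p \<Longrightarrow> v \<in> C" by blast
    have v: "if ah p \<and> arrowhead G w v then v \<in> C else v \<notin> Z"
      using step.hyps(3) p(4,5) by (auto split: if_splits)
    have ne: "p \<noteq> []" and path: "path G p" using p(1) by (auto simp: open_path_def path_def)
    have last: "p ! (length p - 1) = v" using p(3) ne by (simp add: last_conv_nth)
    show ?case
    proof (cases "w \<in> set p")
      case False
      have "path G (p @ [w])"
        using path False p(3) step.hyps(2) adjacent_nodes[OF ancestral_imp_mixed step.hyps(2)]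
        by (auto simp: path_def successively_append_iff)
      moreover have "if collider G (p @ [w]) i then (p @ [w]) ! i \<in> C else (p @ [w]) ! i \<notin> Z"
        if i: "i < length p" for i
      proof (cases "Suc i < length p")
        case True
        then have "collider G (p @ [w]) i \<longleftrightarrow> collider G p i"
          by (auto simp: collider_def nth_append)
        with True p(1) show ?thesis by (auto simp: open_path_def nth_append)
      next
        case False
        with i have i: "i = length p - 1" by simp
        have "collider G (p @ [w]) i \<longleftrightarrow> ah p \<and> arrowhead G w v"
          using last ne p(3) unfolding i by (auto simp: collider_def nth_append ah_def numeral_2_eq_2)
        with v i last ne show ?thesis by (simp add: nth_append)
      qed
      ultimately have "open_path G Z C (p @ [w])" by (simp add: open_path_def)
      moreover have "ah (p @ [w]) = arrowhead G v w"
        using ne last by (simp add: ah_def nth_append)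
      ultimately show ?thesis using p(2) ne by (intro exI[of _ "p @ [w]"]) auto
    next
      case True
      then obtain i where i: "i < length p" "p ! i = w" by (auto simp: in_set_conv_nth)
      have "w \<noteq> v" using step.hyps(2) adjacent_irrefl[OF ancestral_imp_mixed] by blast
      with i last have Si: "Suc i < length p" by (metis Suc_lessI diff_Suc_1)
      define q where "q = take (Suc i) p"
      have len: "length q = Suc i" using i by (simp add: q_def)
      have q: "open_path G Z C q" using p(1) i by (simp add: q_def open_path_take)
      have lq: "last q = w" "hd q \<in> S"
        using i p(2) ne by (auto simp: q_def take_Suc_conv_app_nth hd_append hd_conv_nth)
      have ahq: "ah q \<longleftrightarrow> 0 < i \<and> arrowhead G (p ! (i - 1)) w"
        using lq len by (auto simp: ah_def q_def)
      \<comment> \<open>Without an arrowhead on arrival, \<open>w\<close> was already a non-collider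
        of \<open>p\<close>, and it is not the exempt last node of \<open>p\<close>.\<close>
      have "w \<notin> Z" if "\<not> ah q"
      proof -
        have "\<not> collider G p i" using that i unfolding ahq collider_def by auto
        then show ?thesis using p(1) Si i by (auto simp: open_path_def)
      qed
      \<comment> \<open>If \<open>w\<close> were outside \<open>C\<close>, the part of
        \<open>p\<close> from \<open>w\<close> to \<open>v\<close> would be directed and arrive with
        an arrowhead. The edge between \<open>w\<close> and \<open>v\<close> is then directed
        towards \<open>v\<close> as well, so \<open>v\<close> was passed as a collider in
        \<open>C\<close>, and closure under parents puts \<open>w\<close> into
        \<open>C\<close>.\<close>
      moreover have "w \<in> C" if h: "\<not> arrowhead G v w" and "ah q"
      proof (rule ccontr)
        assume wC: "w \<notin> C"
        from that have i0: "0 < i" "arrowhead G (p ! (i - 1)) (p ! i)" using ahq i by auto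
        have *: "(w, v) \<in> (dir G)\<^sup>* \<and> arrowhead G (p ! (length p - 1 - 1)) v"
          using directed_until_collider[OF p(1) C i0, where j = "length p - 1"] wC i Si last by simp
        have "adjacent G w v" using step.hyps(2) adjacent_sym[OF ancestral_imp_mixed] by blast
        then have wv: "(w, v) \<in> dir G" using h i0 i tail_after_arrowhead by blast
        moreover have "ah p"
          using * Si p(3) by (simp add: ah_def numeral_2_eq_2)
        ultimately have "v \<in> C" using v by (auto simp: arrowhead_def)
        with C wv wC show False by blast
      qed
      ultimately show ?thesis using q lq by blast
    qed
  qed
  then show ?thesis by blast
qed

lemma open_path_imp_walk_to:
  assumes p: "open_path G Z C p" "hd p \<in> S" and i: "i < length p"
  shows "walk_to G Z C S (0 < i \<and> arrowhead G (p ! (i - 1)) (p ! i)) (p ! i)"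
  using i
proof (induction i)
  case 0
  then show ?case using p by (auto simp: hd_conv_nth intro: walk_to.start)
next
  case (Suc i)
  have "walk_to G Z C S (arrowhead G (p ! i) (p ! Suc i)) (p ! Suc i)"
  proof (rule walk_to.step)
    show "walk_to G Z C S (0 < i \<and> arrowhead G (p ! (i - 1)) (p ! i)) (p ! i)" using Suc by simp
    show "adjacent G (p ! i) (p ! Suc i)" using p Suc by (simp add: open_path_def path_nth_adjacent)
    show "if (0 < i \<and> arrowhead G (p ! (i - 1)) (p ! i)) \<and> arrowhead G (p ! Suc i) (p ! i)
      then p ! i \<in> C else p ! i \<notin> Z"
      using p Suc.prems by (auto simp: open_path_def collider_def)
  qed
  then show ?case by simp
qed

lemma m_connected_iff_open_path:
  assumes "w \<notin> Z"
  shows "m_connected G Z u w \<longleftrightarrow> (\<exists>p. open_path G Z (An G Z) p \<and> hd p = u \<and> last p = w)"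
proof -
  have "(\<forall>i<length p. if collider G p i then p ! i \<in> An G Z else p ! i \<notin> Z) \<longleftrightarrow>
      (\<forall>i. Suc i < length p \<longrightarrow> (if collider G p i then p ! i \<in> An G Z else p ! i \<notin> Z))"
    if "path G p" "last p = w" for p
  proof -
    have ne: "p \<noteq> []" using that by (simp add: path_def)
    \<comment> \<open>The last node is never a collider, so \<open>m_connected\<close> demands of it
      exactly what is assumed of \<open>w\<close>.\<close>
    then have "\<not> collider G p (length p - 1)" "p ! (length p - 1) \<notin> Z"
      using assms that by (auto simp: collider_def last_conv_nth)
    then show ?thesis
      using ne by (metis Suc_lessD Suc_lessI diff_Suc_1)
  qed
  then show ?thesis unfolding m_connected_def open_path_def by blast
qed

lemma m_connected_iff_walk_to:
  assumes "S \<subseteq> nodes G" "w \<notin> Z"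
  shows "(\<exists>u\<in>S. m_connected G Z u w) \<longleftrightarrow> (\<exists>h. walk_to G Z (An G Z) S h w)"
proof
  assume "\<exists>u\<in>S. m_connected G Z u w"
  then obtain p where p: "open_path G Z (An G Z) p" "hd p \<in> S" "last p = w"
    using m_connected_iff_open_path[OF assms(2)] by auto
  then have "p \<noteq> []" by (auto simp: open_path_def path_def)
  then show "\<exists>h. walk_to G Z (An G Z) S h w"
    using open_path_imp_walk_to[OF p(1,2), of "length p - 1"] p(3) by (auto simp: last_conv_nth)
next
  assume "\<exists>h. walk_to G Z (An G Z) S h w"
  then show "\<exists>u\<in>S. m_connected G Z u w"
    using walk_to_imp_open_path[of "An G Z", OF _ assms(1)] An_parent[OF ancestral_imp_mixed]
      m_connected_iff_open_path[OF assms(2)] by metis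
qed

text \<open>A collider in \<open>An G Z\<close> outside \<open>Z\<close> is replaced by a detour down to \<open>Z\<close> and back.\<close>

lemma walk_to_detour:
  assumes "(v, z) \<in> (dir G)\<^sup>*" "z \<in> Z" "v \<notin> Z" "walk_to G Z Z S h v"
  shows "walk_to G Z Z S False v"
  using assms
proof (induction arbitrary: h rule: converse_rtrancl_induct)
  case (step v v')
  have adj: "adjacent G v v'" "adjacent G v' v"
    and head: "arrowhead G v v'" "\<not> arrowhead G v' v"
    using step.hyps(1) dir_not_arrowhead by (auto simp: adjacent_def arrowhead_def)
  have v': "walk_to G Z Z S True v'"
    using walk_to.step[OF step.prems(3) adj(1)] head step.prems(2) by simp
  show ?case
  proof (cases "v' \<in> Z")
    case True
    then show ?thesis using walk_to.step[OF v' adj(2)] head by simp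
  next
    case False
    then have "walk_to G Z Z S False v'" using step.IH step.prems v' by blast
    from walk_to.step[OF this adj(2)] show ?thesis using head False by simp
  qed
qed simp

text \<open>The collider conditions of m-connection (\<open>An G Z\<close>) and of TestSep
  (\<open>Z\<close>) differ only in colliders strictly above \<open>Z\<close>. After the detour such
  a node is re-entered through a tail and passed as a non-collider.\<close>

lemma walk_to_An_iff:
  assumes "S \<subseteq> nodes G" "Z \<subseteq> nodes G"
  shows "walk_to G Z (An G Z) S h v \<longleftrightarrow> walk_to G Z Z S h v"
proof
  assume "walk_to G Z (An G Z) S h v"
  then show "walk_to G Z Z S h v"
  proof (induction rule: walk_to.induct)
    case (step h v w)
    show ?case
    proof (cases "h \<and> arrowhead G w v \<and> v \<notin> Z")
      case True
      with step.hyps obtain z where "(v, z) \<in> (dir G)\<^sup>*" "z \<in> Z" by (auto simp: An_iff[OF ancestral_imp_mixed])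
      then have "walk_to G Z Z S False v" using walk_to_detour True step.IH by blast
      then show ?thesis using walk_to.step[OF _ step.hyps(2), of Z Z S False] True by simp
    next
      case False
      then show ?thesis using walk_to.step[OF step.IH step.hyps(2)] step.hyps(3) by (auto split: if_splits)
    qed
  qed (rule walk_to.start)
next
  have "Z \<subseteq> An G Z" using assms by (auto simp: An_iff[OF ancestral_imp_mixed])
  assume "walk_to G Z Z S h v"
  then show "walk_to G Z (An G Z) S h v"
  proof (induction rule: walk_to.induct)
    case (step h v w)
    then show ?case using \<open>Z \<subseteq> An G Z\<close> walk_to.step[OF step.IH step.hyps(2)] by (auto split: if_splits)
  qed (rule walk_to.start)
qed

text \<open>All descendants of a node outside \<open>An G Z\<close> are outside
  \<open>An G Z\<close>, hence outside \<open>Z\<close>, and each node left on the way down is left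
  by a tail, so none of them is a collider.\<close>

lemma walk_to_down:
  assumes "(v, y) \<in> (dir G)\<^sup>*" "v \<notin> An G Z" "walk_to G Z C S h v" "Z \<subseteq> nodes G"
  shows "\<exists>h. walk_to G Z C S h y"
  using assms
proof (induction arbitrary: h rule: converse_rtrancl_induct)
  case (step v v')
  have "v \<notin> Z" using step.prems by (auto simp: An_iff[OF ancestral_imp_mixed])
  moreover have "v' \<notin> An G Z" using step An_parent[OF ancestral_imp_mixed] by blast
  moreover have "walk_to G Z C S (arrowhead G v v') v'"
    using walk_to.step[OF step.prems(2), of v'] \<open>v \<notin> Z\<close> step.hyps(1) dir_not_arrowhead
    by (auto simp: adjacent_def)
  ultimately show ?case using step.IH step.prems by blast
qed blast

text \<open>Every edge is traversed from head to tail, so the walk meets no collider and arrives at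
  \<open>v\<close> through a tail; the flag \<open>False\<close> makes \<open>v\<close> a
  non-collider in any continuation.\<close>

lemma walk_to_up:
  assumes "(v, x) \<in> (dir G)\<^sup>*" "v \<notin> An G Z" "x \<in> S" "Z \<subseteq> nodes G"
  shows "walk_to G Z C S False v"
  using assms
proof (induction rule: converse_rtrancl_induct)
  case (step v v')
  have "v' \<notin> An G Z" using step An_parent[OF ancestral_imp_mixed] by blast
  then have "v' \<notin> Z" using step.prems by (auto simp: An_iff[OF ancestral_imp_mixed])
  moreover have "adjacent G v' v" "\<not> arrowhead G v' v"
    using step.hyps dir_not_arrowhead by (auto simp: adjacent_def)
  ultimately show ?case
    using step.IH[OF \<open>v' \<notin> An G Z\<close> step.prems(2,3)] walk_to.step[of G Z C S False v' v] by simp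
qed (rule walk_to.start)

text \<open>At a collider outside \<open>An G Z\<close> which is an ancestor of \<open>Y\<close> the walk is diverted to \<open>Y\<close>; if
  it is an ancestor of \<open>X\<close>, the part of the walk before it is replaced by a directed walk from \<open>X\<close>
  against the edges.\<close>

lemma walk_to_Ant:
  assumes "walk_to G Z C X h y" "y \<in> Y" "C \<subseteq> Ant G (X \<union> Y \<union> Z)" "Z \<subseteq> nodes G"
  shows "\<exists>h. \<exists>y\<in>Y. walk_to G Z (An G Z) X h y"
proof (rule ccontr)
  assume no: "\<not> ?thesis"
  \<comment> \<open>The second conjunct remembers an actual arrowhead at the current node; it
    upgrades membership in \<open>Ant\<close> to membership in \<open>An\<close>.\<close>
  have "walk_to G Z (An G Z) X h y \<and> (h \<longrightarrow> (\<exists>t. arrowhead G t y))"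
    using assms(1)
  proof (induction rule: walk_to.induct)
    case (step h v w)
    show ?case
    proof (cases "h \<and> arrowhead G w v \<and> v \<notin> An G Z")
      case True
      then have "v \<in> An G (X \<union> Y \<union> Z)"
        using step.IH step.hyps(3) assms(3) Ant_arrowhead_An by auto
      then obtain s where s: "s \<in> X \<union> Y" "(v, s) \<in> (dir G)\<^sup>*"
        using True by (auto simp: An_iff[OF ancestral_imp_mixed])
      \<comment> \<open>Were \<open>s\<close> in \<open>Y\<close>, the directed walk down to it
        would complete a walk excluded by \<open>no\<close>.\<close>
      then have "s \<in> X"
        using walk_to_down[OF s(2), of Z "An G Z" X h] True step.IH assms(4) no by auto
      then have "walk_to G Z (An G Z) X False v"
        using walk_to_up[OF s(2)] True assms(4) by blast
      moreover have "v \<notin> Z" using True step.hyps assms(4) adjacent_nodes[OF ancestral_imp_mixed] by (auto simp: An_iff[OF ancestral_imp_mixed])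
      ultimately show ?thesis using walk_to.step[OF _ step.hyps(2), of Z "An G Z" X False] by auto
    next
      case False
      then show ?thesis
        using walk_to.step[OF conjunct1[OF step.IH] step.hyps(2)] step.hyps(3) by (auto split: if_splits)
    qed
  qed (auto intro: walk_to.start)
  with no assms(2) show False by blast
qed

section \<open>Open paths stay in the anterior set\<close>

lemma open_path_rev:
  assumes "open_path G Z C p" "last p \<notin> Z"
  shows "open_path G Z C (rev p)"
proof -
  have p: "path G p" using assms by (simp add: open_path_def)
  have "successively (adjacent G) (rev p)"
    using p adjacent_sym[OF ancestral_imp_mixed] by (auto simp: path_def elim: successively_mono)
  then have "path G (rev p)" using p by (auto simp: path_def)
  moreover have "if collider G (rev p) i then rev p ! i \<in> C else rev p ! i \<notin> Z"
    if i: "Suc i < length (rev p)" for i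
  proof (cases "i = 0")
    case True
    moreover have "rev p ! 0 = last p" using i by (cases p rule: rev_cases) auto
    ultimately show ?thesis using assms(2) by (simp add: collider_def)
  next
    case False
    define j where "j = length p - Suc i"
    have j: "Suc j < length p" "0 < j" "rev p ! i = p ! j" "rev p ! (i - 1) = p ! Suc j"
      "rev p ! Suc i = p ! (j - 1)"
      using i False by (auto simp: j_def rev_nth Suc_diff_Suc)
    then have "collider G (rev p) i \<longleftrightarrow> collider G p j"
      using i False by (auto simp: collider_def)
    with j assms(1) show ?thesis by (auto simp: open_path_def)
  qed
  ultimately show ?thesis by (simp add: open_path_def)
qed

text \<open>Having left a node by a tail, the path runs along directed or undirected edges until it
  ends or meets a collider, which lies in \<open>An G Z\<close>.\<close>

lemma open_path_tail_Ant:
  assumes p: "open_path G Z (An G Z) p"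
    and i: "Suc i < length p" "\<not> arrowhead G (p ! Suc i) (p ! i)"
  shows "p ! i \<in> Ant G (insert (last p) Z)"
  using i
proof (induction "length p - i" arbitrary: i rule: less_induct)
  case less
  have adj: "adjacent G (p ! i) (p ! Suc i)" using p less.prems by (simp add: open_path_def path_nth_adjacent)
  then have e: "(p ! i, p ! Suc i) \<in> dir G \<union> undir G" using less.prems adjacent_no_arrowhead by blast
  have "p ! Suc i \<in> Ant G (insert (last p) Z)"
  proof (cases "Suc (Suc i) < length p")
    case False
    then have "p ! Suc i = last p" using less.prems by (metis Suc_lessI diff_Suc_1 last_conv_nth list.size(3) not_less0)
    then show ?thesis using adjacent_nodes[OF ancestral_imp_mixed adj] by (auto simp: Ant_iff[OF ancestral_imp_mixed])
  next
    case True
    show ?thesis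
    proof (cases "collider G p (Suc i)")
      case True
      then have "p ! Suc i \<in> An G Z" using p by (auto simp: open_path_def collider_def)
      then show ?thesis using An_subset_Ant[OF ancestral_imp_mixed] Ant_mono[of Z "insert (last p) Z" G] by blast
    next
      case False
      \<comment> \<open>An arrowhead here, at a non-collider, would need a tail on the edge before
        it; that edge would be undirected and meet an arrowhead, which is impossible.\<close>
      have "\<not> arrowhead G (p ! Suc (Suc i)) (p ! Suc i)"
      proof
        assume *: "arrowhead G (p ! Suc (Suc i)) (p ! Suc i)"
        with False True have "\<not> arrowhead G (p ! i) (p ! Suc i)" by (simp add: collider_def)
        with e have "(p ! Suc i, p ! i) \<in> undir G" using undir_sym[OF ancestral_imp_mixed] by (auto simp: arrowhead_def)
        with * arrowhead_not_undir show False by blast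
      qed
      then show ?thesis using less.hyps[of "Suc i"] True by simp
    qed
  qed
  then show ?case using e adjacent_nodes[OF ancestral_imp_mixed adj]
    by (auto simp: Ant_iff[OF ancestral_imp_mixed] intro: converse_rtrancl_into_rtrancl)
qed

lemma open_path_subset_Ant:
  assumes p: "open_path G Z (An G Z) p" and last: "last p \<notin> Z"
  shows "set p \<subseteq> Ant G ({hd p, last p} \<union> Z)"
proof
  fix v assume "v \<in> set p"
  then obtain i where i: "i < length p" "p ! i = v" by (auto simp: in_set_conv_nth)
  have path: "path G p" using p by (simp add: open_path_def)
  then have ne: "p \<noteq> []" and v: "v \<in> nodes G" using \<open>v \<in> set p\<close> by (auto simp: path_def)
  have self: "v \<in> S \<Longrightarrow> v \<in> Ant G S" for S using v by (auto simp: Ant_iff[OF ancestral_imp_mixed])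
  \<comment> \<open>A node that is neither an endpoint nor a collider has a tail towards one side; a
    tail towards the front is treated on the reversed path.\<close>
  consider "i = 0" | "Suc i = length p" | "collider G p i"
    | "Suc i < length p" "\<not> arrowhead G (p ! Suc i) (p ! i)"
    | "0 < i" "Suc i < length p" "\<not> arrowhead G (p ! (i - 1)) (p ! i)"
    using i by (auto simp: collider_def) linarith
  then show "v \<in> Ant G ({hd p, last p} \<union> Z)"
  proof cases
    case 1
    then show ?thesis using i ne self by (auto simp: hd_conv_nth)
  next
    case 2
    then show ?thesis using i ne self by (metis Un_iff diff_Suc_1 insertCI last_conv_nth)
  next
    case 3
    then have "v \<in> An G Z" using i p by (auto simp: open_path_def collider_def)
    then show ?thesis using An_subset_Ant[OF ancestral_imp_mixed] Ant_mono[of Z "{hd p, last p} \<union> Z" G] by blast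
  next
    case 4
    then have "v \<in> Ant G (insert (last p) Z)" using open_path_tail_Ant[OF p] i by blast
    then show ?thesis using Ant_mono[of "insert (last p) Z" "{hd p, last p} \<union> Z" G] by blast
  next
    case 5
    define j where "j = length p - Suc i"
    have "Suc j < length p" "rev p ! Suc j = p ! (i - 1)" "rev p ! j = p ! i"
      using 5 by (auto simp: j_def rev_nth Suc_diff_Suc)
    then have "v \<in> Ant G (insert (last (rev p)) Z)"
      using open_path_tail_Ant[OF open_path_rev[OF p last], of j] 5 i by auto
    then show ?thesis using ne Ant_mono[of "insert (hd p) Z" "{hd p, last p} \<union> Z" G] by (auto simp: last_rev)
  qed
qed

end

section \<open>Worklist searches\<close>

text \<open>Each element costs one step for the loop and one for the body; the remaining step is
  that of the empty list.\<close>

lemma foreach_tick: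
  assumes "\<And>x s. f x s = tick (g x s)"
  shows "foreach xs f s = Result (fold g xs s) (2 * length xs + 1)"
  using assms by (induction xs arbitrary: s) (auto simp: tick_def)

text \<open>The potential both proves termination and pays for the run: its strict decrease pays for
  the loop step of each iteration, the final \<open>+ 1\<close> for the step before the first
  test.\<close>

lemma while_timed_rule:
  fixes \<Phi> :: "'s \<Rightarrow> nat"
  assumes "Inv s"
    and body: "\<And>s. Inv s \<Longrightarrow> b s \<Longrightarrow> \<exists>s' t. c s = Result s' t \<and> Inv s' \<and> \<Phi> s' + t < \<Phi> s"
  shows "\<exists>s' t. while_timed b c s = Result s' t \<and> Inv s' \<and> \<not> b s' \<and> t + \<Phi> s' \<le> \<Phi> s + 1"
proof -
  let ?b = "\<lambda>r. case r of Diverges \<Rightarrow> False | Result s t \<Rightarrow> b s"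
  let ?c = "\<lambda>r. do { s \<leftarrow> r; s \<leftarrow> tick s; c s }"
  \<comment> \<open>The iterated state carries the cost so far, so the induction is over an
    arbitrary cost \<open>t0\<close> already spent.\<close>
  have "\<exists>s' t. while_option ?b ?c (Result s t0) = Some (Result s' (t0 + t)) \<and> Inv s' \<and> \<not> b s' \<and>
      t + \<Phi> s' \<le> \<Phi> s" if "Inv s" for s t0
    using that
  proof (induction "\<Phi> s" arbitrary: s t0 rule: less_induct)
    case less
    show ?case
    proof (cases "b s")
      case False
      then show ?thesis using less.prems while_option_unfold[of ?b ?c "Result s t0"]
        by (intro exI[of _ s] exI[of _ 0]) simp
    next
      case True
      then obtain s' t where s': "c s = Result s' t" "Inv s'" "\<Phi> s' + t < \<Phi> s"
        using body less.prems by blast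
      then have c: "?c (Result s t0) = Result s' (t0 + (1 + t))" by (simp add: tick_def)
      obtain s'' t' where w: "while_option ?b ?c (Result s' (t0 + (1 + t))) = Some (Result s'' (t0 + (1 + t) + t'))"
        "Inv s''" "\<not> b s''" "t' + \<Phi> s'' \<le> \<Phi> s'"
        using less.hyps[of s' "t0 + (1 + t)"] s' by auto
      have "while_option ?b ?c (Result s t0) = Some (Result s'' (t0 + (1 + t + t')))"
        using while_option_unfold[of ?b ?c "Result s t0"] w(1) True unfolding c by (simp add: add.assoc)
      then show ?thesis using s'(3) w(2-4)
        by (intro exI[of _ s''] exI[of _ "1 + t + t'"]) simp
    qed
  qed
  from this[OF assms(1), of 1] obtain s' t where w: "while_option ?b ?c (Result s 1) = Some (Result s' (1 + t))"
    "Inv s'" "\<not> b s'" "t + \<Phi> s' \<le> \<Phi> s" by blast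
  have tick: "tick s = Result s 1" by (simp add: tick_def)
  have "while_timed b c s = Result s' (1 + t)"
    unfolding while_timed_def tick w(1) by simp
  with w(2-) show ?thesis by auto
qed

text \<open>The filter \<open>c\<close> serves TestSep, which tests edges while pushing; for
  \<open>add_new\<close> it is \<open>True\<close>. Repetitions in \<open>ss\<close> are harmless,
  since a pushed element belongs to \<open>Q\<close> from then on.\<close>

lemma fold_push:
  assumes "distinct P" "set P \<subseteq> Q"
    and "fold (\<lambda>s (P, Q). if c s \<and> s \<notin> Q then (s # P, insert s Q) else (P, Q)) ss (P, Q) = (P', Q')"
  shows "distinct P' \<and> set P' = set P \<union> ({s \<in> set ss. c s} - Q) \<and> Q' = Q \<union> {s \<in> set ss. c s}"
  using assms
proof (induction ss arbitrary: P Q)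
  case (Cons s ss)
  show ?case
  proof (cases "c s \<and> s \<notin> Q")
    case True
    have "distinct P' \<and> set P' = set (s # P) \<union> ({s \<in> set ss. c s} - insert s Q) \<and>
        Q' = insert s Q \<union> {s \<in> set ss. c s}"
      using True Cons.prems by (intro Cons.IH) auto
    then show ?thesis using True Cons.prems(2) by auto
  next
    case False
    then show ?thesis using Cons.IH[of P Q] Cons.prems by auto
  qed
qed auto

text \<open>\<open>initial\<close> pushes without a membership test, so the distinctness of
  \<open>vs\<close> and the injectivity of \<open>h\<close> keep the worklist free of
  repetitions.\<close>

lemma initial_result:
  assumes "distinct vs" "inj h"
  shows "\<exists>P. initial vs S h = Result (P, set P) (2 * length vs + 1) \<and> distinct P \<and>
    set P = h ` {v \<in> set vs. S v}"
proof -
  let ?g = "\<lambda>v (P, Q). if S v then (h v # P, insert (h v) Q) else (P, Q)"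
  have "\<exists>P'. fold ?g vs (P, set P) = (P', set P') \<and> distinct P' \<and> set P' = set P \<union> h ` {v \<in> set vs. S v}"
    if "distinct P" "h ` set vs \<inter> set P = {}" for P
    using assms(1) that
  proof (induction vs arbitrary: P)
    case (Cons v vs)
    then have "\<exists>P'. fold ?g vs (h v # P, set (h v # P)) = (P', set P') \<and> distinct P' \<and>
        set P' = set (h v # P) \<union> h ` {v \<in> set vs. S v}"
      using assms(2) by (intro Cons.IH) (auto simp: inj_def)
    moreover have "\<exists>P'. fold ?g vs (P, set P) = (P', set P') \<and> distinct P' \<and>
        set P' = set P \<union> h ` {v \<in> set vs. S v}"
      using Cons.prems by (intro Cons.IH) auto
    ultimately show ?case by (cases "S v") auto
  qed auto
  from this[of "[]"] obtain P' where "fold ?g vs ([], {}) = (P', set P')" "distinct P'"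
    "set P' = h ` {v \<in> set vs. S v}" by auto
  moreover have "initial vs S h = Result (fold ?g vs ([], {})) (2 * length vs + 1)"
    unfolding initial_def by (rule foreach_tick) (auto split: prod.split)
  ultimately show ?thesis by simp
qed

lemma add_new_result:
  assumes "distinct P" "set P \<subseteq> Q"
  shows "\<exists>P'. add_new ss (P, Q) = Result (P', Q \<union> set ss) (2 * length ss + 1) \<and> distinct P' \<and>
    set P' = set P \<union> (set ss - Q)"
proof -
  let ?g = "\<lambda>s (P, Q). if True \<and> s \<notin> Q then (s # P, insert s Q) else (P, Q)"
  obtain P' Q' where *: "fold ?g ss (P, Q) = (P', Q')" by (rule prod.exhaust)
  have "add_new ss (P, Q) = Result (fold ?g ss (P, Q)) (2 * length ss + 1)"
    unfolding add_new_def by (rule foreach_tick) (auto split: prod.split)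
  then have "add_new ss (P, Q) = Result (P', Q') (2 * length ss + 1)" by (simp only: *)
  with fold_push[OF assms *] show ?thesis by simp
qed

lemma set_fold_append: "set (fold (\<lambda>x ys. f x @ ys) xs ys) = (\<Union>x\<in>set xs. set (f x)) \<union> set ys"
  by (induction xs arbitrary: ys) auto

lemma length_fold_append:
  assumes "\<And>x. length (f x) \<le> k"
  shows "length (fold (\<lambda>x ys. f x @ ys) xs ys) \<le> k * length xs + length ys"
proof (induction xs arbitrary: ys)
  case (Cons x xs)
  from Cons.IH[of "f x @ ys"] show ?case using assms[of x] by simp
qed simp

text \<open>TestSep stops when a state of \<open>F\<close> is removed from the worklist \<open>P\<close>; the other searches have
  \<open>F = {}\<close>.\<close>

definition search_inv :: "'s rel \<Rightarrow> 's set \<Rightarrow> 's set \<Rightarrow> 's set \<Rightarrow> 's set \<Rightarrow> bool" where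
  "search_inv r I F P Q \<longleftrightarrow> P \<subseteq> Q \<and> I \<subseteq> Q \<and> Q \<subseteq> r\<^sup>* `` I \<and> (\<forall>s\<in>Q - P. s \<notin> F \<and> r `` {s} \<subseteq> Q)"

lemma search_inv_start: "search_inv r I F I I"
  unfolding search_inv_def by blast

lemma search_inv_step:
  assumes inv: "search_inv r I F P Q" and s: "s \<in> P" "s \<notin> F"
  shows "search_inv r I F (P - {s} \<union> (r `` {s} - Q)) (Q \<union> r `` {s})"
proof -
  have "s \<in> r\<^sup>* `` I" using assms unfolding search_inv_def by blast
  then obtain i where "i \<in> I" "(i, s) \<in> r\<^sup>*" by blast
  then have "r `` {s} \<subseteq> r\<^sup>* `` I" by (blast intro: rtrancl_into_rtrancl)
  moreover have "t \<notin> F \<and> r `` {t} \<subseteq> Q \<union> r `` {s}"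
    if "t \<in> (Q \<union> r `` {s}) - (P - {s} \<union> (r `` {s} - Q))" for t
    using that inv s unfolding search_inv_def by (cases "t = s") blast+
  ultimately show ?thesis using inv unfolding search_inv_def by (intro conjI ballI) auto
qed

lemma search_inv_done:
  assumes "search_inv r I F {} Q"
  shows "Q = r\<^sup>* `` I" "Q \<inter> F = {}"
proof -
  have "t \<in> Q" if "(s, t) \<in> r\<^sup>*" "s \<in> I" for s t
    using that by (induction rule: rtrancl_induct) (use assms in \<open>auto simp: search_inv_def\<close>)
  then show "Q = r\<^sup>* `` I" using assms by (auto simp: search_inv_def)
  show "Q \<inter> F = {}" using assms by (auto simp: search_inv_def)
qed

text \<open>A state turns from undiscovered to pending to finished and pays \<open>K\<close> when it
  leaves the worklist. Discovering \<open>N - Q\<close> only shifts weight between the two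
  sums.\<close>

lemma worklist_potential:
  fixes K :: "'s \<Rightarrow> nat"
  assumes "finite U" "Q \<subseteq> U" "N \<subseteq> U" "s \<in> P" "P \<subseteq> Q"
  shows "sum K (P - {s} \<union> (N - Q)) + sum K (U - (Q \<union> N)) + K s = sum K P + sum K (U - Q)"
proof -
  have fin: "finite P" "finite N"
    using assms(1,3) finite_subset[OF subset_trans[OF assms(5,2)]] finite_subset by auto
  have "sum K (P - {s} \<union> (N - Q)) = sum K (P - {s}) + sum K (N - Q)"
    using assms fin by (intro sum.union_disjoint) auto
  moreover have "sum K (U - Q) = sum K (N - Q) + sum K (U - (Q \<union> N))"
    using assms fin by (subst sum.union_disjoint[symmetric]) (auto intro!: sum.cong)
  moreover have "sum K P = K s + sum K (P - {s})" using assms fin by (simp add: sum.remove)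
  ultimately show ?thesis by simp
qed

text \<open>\<open>K s\<close> covers computing the successors (\<open>t\<close>), pushing them
  (\<open>2 * length ss + 1\<close>) and the loop step. A state is processed at most once, whence
  \<open>sum K U\<close>; two more steps start the loop and return \<open>Q\<close>.\<close>

lemma search_result:
  assumes U: "finite U" "set P \<subseteq> U" and P: "distinct P"
    and succs: "\<And>s. s \<in> U \<Longrightarrow> \<exists>ss t. succs s = Result ss t \<and> set ss = r `` {s} \<and> set ss \<subseteq> U \<and>
      t + 2 * length ss + 2 \<le> K s"
  shows "\<exists>t. search succs (P, set P) = Result (r\<^sup>* `` set P) t \<and> t \<le> sum K U + 2"
proof -
  define Inv where "Inv PQ = (case PQ of (P', Q) \<Rightarrow> distinct P' \<and> Q \<subseteq> U \<and> search_inv r (set P) {} (set P') Q)" for PQ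
  define \<Phi> where "\<Phi> PQ = (case PQ of (P', Q) \<Rightarrow> sum K (set P') + sum K (U - Q))" for PQ
  let ?b = "\<lambda>(P, Q). P \<noteq> []" and ?c = "\<lambda>(P, Q). do { ss \<leftarrow> succs (hd P); add_new ss (tl P, Q) }"
  have "\<exists>s' t. while_timed ?b ?c (P, set P) = Result s' t \<and> Inv s' \<and> \<not> ?b s' \<and> t + \<Phi> s' \<le> \<Phi> (P, set P) + 1"
  proof (rule while_timed_rule)
    show "Inv (P, set P)" using U P by (simp add: Inv_def search_inv_start)
    fix s assume "Inv s" "?b s"
    then obtain x P' Q where s: "s = (x # P', Q)" by (cases s) (auto simp: neq_Nil_conv)
    have inv: "distinct (x # P')" "Q \<subseteq> U" "search_inv r (set P) {} (set (x # P')) Q"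
      using \<open>Inv s\<close> by (auto simp: Inv_def s)
    then have sub: "set (x # P') \<subseteq> Q" by (simp add: search_inv_def)
    then have "x \<in> U" using inv(2) by auto
    then obtain ss t where ss: "succs x = Result ss t" "set ss = r `` {x}" "set ss \<subseteq> U"
      "t + 2 * length ss + 2 \<le> K x" using succs \<open>x \<in> U\<close> by blast
    obtain P'' where P'': "add_new ss (P', Q) = Result (P'', Q \<union> set ss) (2 * length ss + 1)"
      "distinct P''" "set P'' = set P' \<union> (set ss - Q)"
      using add_new_result[of P' Q ss] inv sub by auto
    have set_P'': "set P'' = set (x # P') - {x} \<union> (r `` {x} - Q)" using P''(3) ss(2) inv(1) by auto
    have rU: "r `` {x} \<subseteq> U" using ss by simp
    have "search_inv r (set P) {} (set P'') (Q \<union> r `` {x})"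
      unfolding set_P'' by (rule search_inv_step[OF inv(3)]) simp_all
    then have "Inv (P'', Q \<union> set ss)"
      using P''(2) inv(2) rU by (simp add: Inv_def ss(2))
    moreover have "\<Phi> (P'', Q \<union> set ss) + K x = \<Phi> s"
      unfolding \<Phi>_def s prod.case set_P'' ss(2)
      by (rule worklist_potential[OF U(1) inv(2) rU _ sub]) simp
    ultimately show "\<exists>s' t. ?c s = Result s' t \<and> Inv s' \<and> \<Phi> s' + t < \<Phi> s"
      using ss P'' by (auto simp: s)
  qed
  then obtain Q t where w: "while_timed ?b ?c (P, set P) = Result ([], Q) t" "Inv ([], Q)"
    "t + \<Phi> ([], Q) \<le> \<Phi> (P, set P) + 1" by auto
  have "sum K (set P) + sum K (U - set P) = sum K U"
    using U by (metis add.commute sum.subset_diff)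
  then have "t \<le> sum K U + 1" using w(3) by (simp add: \<Phi>_def)
  moreover have "Q = r\<^sup>* `` set P" using w(2) search_inv_done(1)[of r "set P" "{}" Q] by (simp add: Inv_def)
  ultimately show ?thesis using w(1) by (auto simp: search_def tick_def)
qed

section \<open>TestSep as reachability of states\<close>

definition test_sep_rel :: "'v mixed_graph \<Rightarrow> 'v set \<Rightarrow> (edge_type \<times> 'v) rel" where
  "test_sep_rel G Z = {((e, T), (f, N)). joins G T f N \<and> m_connecting Z e T f}"

text \<open>The invariant survives the removal of any pair, so the choice left open by the procedure
  cannot influence its outcome.\<close>

lemma test_sep_loop_sound:
  assumes "test_sep_loop G Y Z P Q b" "search_inv (test_sep_rel G Z) I {s. snd s \<in> Y} P Q"
  shows "b \<longleftrightarrow> (test_sep_rel G Z)\<^sup>* `` I \<inter> {s. snd s \<in> Y} = {}"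
  using assms
proof (induction rule: test_sep_loop.induct)
  case (1 Q)
  then show ?case using search_inv_done by blast
next
  case (2 e T P Q)
  then have "(e, T) \<in> (test_sep_rel G Z)\<^sup>* `` I \<inter> {s. snd s \<in> Y}"
    by (auto simp: search_inv_def)
  then show ?case by blast
next
  case (3 e T P New Q b)
  have "New = test_sep_rel G Z `` {(e, T)} - Q" using 3(3) by (auto simp: test_sep_rel_def)
  moreover have "search_inv (test_sep_rel G Z) I {s. snd s \<in> Y}
      (P - {(e, T)} \<union> (test_sep_rel G Z `` {(e, T)} - Q)) (Q \<union> test_sep_rel G Z `` {(e, T)})"
    by (rule search_inv_step[OF 3(6) 3(1)]) (use 3(2) in simp)
  ultimately show ?case using 3(5) by simp
qed

lemma finite_edge_type: "finite (UNIV :: edge_type set)"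
  and card_edge_type: "card (UNIV :: edge_type set) = 4"
proof -
  have "(UNIV :: edge_type set) = {Right, Left, Undirected, Bidirected}"
    by (auto intro: edge_type.exhaust)
  moreover have "finite {Right, Left, Undirected, Bidirected}" by simp
  moreover have "card {Right, Left, Undirected, Bidirected} = 4" by simp
  ultimately show "finite (UNIV :: edge_type set)" "card (UNIV :: edge_type set) = 4" by metis+
qed

lemma joins_nodes: "mixed_graph G \<Longrightarrow> joins G u f v \<Longrightarrow> u \<in> nodes G \<and> v \<in> nodes G"
  by (cases f) (auto simp: mixed_graph_def)

text \<open>The number of pending and undiscovered states together drops by one in each round; this
  is \<open>worklist_potential\<close> with unit weights.\<close>

lemma test_sep_loop_terminates:
  assumes G: "mixed_graph G" and "P \<subseteq> UNIV \<times> nodes G" "P \<subseteq> Q" "Q \<subseteq> UNIV \<times> nodes G"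
  shows "\<exists>b. test_sep_loop G Y Z P Q b"
  using assms(2-)
proof (induction "card P + card (UNIV \<times> nodes G - Q)" arbitrary: P Q rule: less_induct)
  case less
  have U: "finite ((UNIV :: edge_type set) \<times> nodes G)"
    using G by (intro finite_cartesian_product finite_edge_type) (simp add: mixed_graph_def)
  show ?case
  proof (cases "P = {}")
    case True
    then show ?thesis using test_sep_loop.intros(1) by blast
  next
    case False
    then obtain e T where eT: "(e, T) \<in> P" by auto
    define New where "New = {(f, N). joins G T f N \<and> m_connecting Z e T f \<and> (f, N) \<notin> Q}"
    have New: "New \<subseteq> UNIV \<times> nodes G" "New \<inter> Q = {}" using joins_nodes[OF G] by (auto simp: New_def)
    have "card (P - {(e, T)} \<union> New) + card (UNIV \<times> nodes G - (Q \<union> New)) + 1 =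
        card P + card (UNIV \<times> nodes G - Q)"
      using worklist_potential[OF U less.prems(3) New(1) eT less.prems(2), of "\<lambda>_. 1"] New(2)
      by (simp add: Diff_triv)
    moreover have "P - {(e, T)} \<union> New \<subseteq> UNIV \<times> nodes G" "P - {(e, T)} \<union> New \<subseteq> Q \<union> New"
      "Q \<union> New \<subseteq> UNIV \<times> nodes G"
      using less.prems New(1) by blast+
    ultimately obtain b where b: "test_sep_loop G Y Z (P - {(e, T)} \<union> New) (Q \<union> New) b"
      using less.hyps[of "P - {(e, T)} \<union> New" "Q \<union> New"] by auto
    show ?thesis
    proof (cases "T \<in> Y")
      case True
      then show ?thesis using test_sep_loop.intros(2)[OF eT] by blast
    next
      case False
      then show ?thesis using test_sep_loop.intros(3)[OF eT _ New_def b] by blast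
    qed
  qed
qed

text \<open>Soundness makes the loop relation single-valued and termination makes it total, which
  turns it into an equation for the outcome.\<close>

lemma test_sep_iff:
  assumes "mixed_graph G" "X \<subseteq> nodes G"
  shows "test_sep G X Y Z b \<longleftrightarrow>
    b = ((test_sep_rel G Z)\<^sup>* `` (Pair Left ` X) \<inter> {s. snd s \<in> Y} = {})"
proof -
  have P: "{(Left, x) |x. x \<in> X} = Pair Left ` X" by auto
  let ?D = "(test_sep_rel G Z)\<^sup>* `` (Pair Left ` X) \<inter> {s. snd s \<in> Y} = {}"
  obtain b' where b': "test_sep_loop G Y Z (Pair Left ` X) (Pair Left ` X) b'"
    using test_sep_loop_terminates[OF assms(1), of "Pair Left ` X" "Pair Left ` X"] assms(2) by blast
  have sound: "b = ?D" if "test_sep_loop G Y Z (Pair Left ` X) (Pair Left ` X) b" for b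
    using test_sep_loop_sound[OF that search_inv_start] .
  show ?thesis
    unfolding test_sep_def P Let_def
  proof
    show "test_sep_loop G Y Z (Pair Left ` X) (Pair Left ` X) b \<Longrightarrow> b = ?D" by (rule sound)
    show "b = ?D \<Longrightarrow> test_sep_loop G Y Z (Pair Left ` X) (Pair Left ` X) b"
      using b' by (simp only: sound[OF b'])
  qed
qed

section \<open>Running times of the anterior search and of TestSep\<close>

context
  fixes G :: "'v mixed_graph" and vs adj
  assumes G: "mixed_graph G" and adj: "adjacency_lists G vs adj"
begin

lemma nodes_list: "distinct vs" "set vs = nodes G" "length vs = card (nodes G)"
  using adj distinct_card[of vs] by (auto simp: adjacency_lists_def)

lemma set_adj: "u \<in> nodes G \<Longrightarrow> set (adj u) = {(e, v). joins G u e v}"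
  using adj by (auto simp: adjacency_lists_def)

definition total_degree :: nat where
  "total_degree = (\<Sum>v\<in>nodes G. length (adj v))"

lemma sum_affine_length:
  "(\<Sum>v\<in>nodes G. a * length (adj v) + b) = a * total_degree + b * card (nodes G)"
  by (simp add: total_degree_def sum.distrib sum_distrib_left mult.commute)

lemma finite_nodes: "finite (nodes G)"
  using G by (simp add: mixed_graph_def)

lemma finite_edges: "finite (edges G)"
proof (rule finite_subset)
  show "edges G \<subseteq> Pow (nodes G)"
    using G by (auto simp: edges_def adjacent_def mixed_graph_def)
qed (simp add: finite_nodes)

text \<open>The factor 8 stands for 4 edge types in each of the 2 orientations of an edge.\<close>

lemma total_degree_le: "total_degree \<le> 8 * card (edges G)"
proof -
  let ?N = "{(u, v). adjacent G u v}"
  have "?N \<subseteq> nodes G \<times> nodes G"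
    using G unfolding adjacent_def mixed_graph_def by blast
  then have fin: "finite ?N" by (rule finite_subset) (intro finite_cartesian_product finite_nodes)
  have "total_degree = (\<Sum>v\<in>nodes G. card (set (adj v)))"
    unfolding total_degree_def
  proof (rule sum.cong[OF refl])
    fix v assume "v \<in> nodes G"
    then have "distinct (adj v)" using adj unfolding adjacency_lists_def by blast
    then show "length (adj v) = card (set (adj v))" by (simp only: distinct_card)
  qed
  also have "\<dots> = card (SIGMA v:nodes G. set (adj v))"
    using finite_nodes by simp
  also have "\<dots> \<le> card ((\<lambda>((u, v), e). (u, e, v)) ` (?N \<times> (UNIV :: edge_type set)))"
  proof (rule card_mono)
    show "(SIGMA v:nodes G. set (adj v)) \<subseteq> (\<lambda>((u, v), e). (u, e, v)) ` (?N \<times> (UNIV :: edge_type set))"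
    proof clarify
      fix u e v assume "u \<in> nodes G" "(e, v) \<in> set (adj u)"
      then have "joins G u e v" by (simp add: set_adj)
      then have "adjacent G u v" by (cases e) (auto simp: adjacent_def)
      then show "(u, e, v) \<in> (\<lambda>((u, v), e). (u, e, v)) ` (?N \<times> (UNIV :: edge_type set))"
        by (intro image_eqI[of _ _ "((u, v), e)"]) auto
    qed
    show "finite ((\<lambda>((u, v), e). (u, e, v)) ` (?N \<times> (UNIV :: edge_type set)))"
      by (intro finite_imageI finite_cartesian_product fin finite_edge_type)
  qed
  also have "\<dots> \<le> card (?N \<times> (UNIV :: edge_type set))"
    by (intro card_image_le finite_cartesian_product fin finite_edge_type)
  also have "\<dots> = 4 * card ?N" by (simp add: card_cartesian_product card_edge_type)
  finally have le: "total_degree \<le> 4 * card ?N" .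
  have "card ?N \<le> card (\<Union>E\<in>edges G. {(u, v). E = {u, v}})"
  proof (rule card_mono)
    have sub: "{(u, v). E = {u, v}} \<subseteq> E \<times> E" for E :: "'v set" by auto
    have fin_E: "finite E" if "E \<in> edges G" for E using that by (auto simp: edges_def)
    have "finite {(u, v). E = {u, v}}" if "E \<in> edges G" for E
      by (rule finite_subset[OF sub]) (use fin_E[OF that] in simp)
    then show "finite (\<Union>E\<in>edges G. {(u, v). E = {u, v}})"
      by (intro finite_UN_I finite_edges)
    show "?N \<subseteq> (\<Union>E\<in>edges G. {(u, v). E = {u, v}})"
    proof clarify
      fix u v assume "adjacent G u v"
      then have "{u, v} \<in> edges G" unfolding edges_def by blast
      then show "(u, v) \<in> (\<Union>E\<in>edges G. {(u, v). E = {u, v}})" by blast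
    qed
  qed
  also have "\<dots> \<le> (\<Sum>E\<in>edges G. card {(u, v). E = {u, v}})" by (rule card_UN_le[OF finite_edges])
  also have "\<dots> \<le> (\<Sum>E\<in>edges G. 2)"
  proof (rule sum_mono)
    fix E assume "E \<in> edges G"
    then obtain a b where "E = {a, b}" by (auto simp: edges_def)
    have "(u, v) \<in> {(a, b), (b, a)}" if "E = {u, v}" for u v
      using that unfolding \<open>E = {a, b}\<close> doubleton_eq_iff by blast
    then have "{(u, v). E = {u, v}} \<subseteq> {(a, b), (b, a)}" by blast
    then have "card {(u, v). E = {u, v}} \<le> card {(a, b), (b, a)}" by (rule card_mono[rotated]) simp
    also have "\<dots> \<le> 2" using card_length[of "[(a, b), (b, a)]"] by simp
    finally show "card {(u, v). E = {u, v}} \<le> 2" .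
  qed
  also have "\<dots> = 2 * card (edges G)" by simp
  finally have "card ?N \<le> 2 * card (edges G)" .
  with le show ?thesis by linarith
qed

text \<open>Anteriors are searched backwards along edges, hence the converse relation. An entry of
  an adjacency list costs two steps to read and, yielding at most one node, two to push.\<close>

lemma anteriors_prog_result:
  assumes "\<And>v. S v \<Longrightarrow> v \<in> nodes G"
  shows "\<exists>t. anteriors_prog vs adj S = Result {u. \<exists>w. S w \<and> (u, w) \<in> (dir G \<union> undir G)\<^sup>*} t \<and>
    t \<le> 4 * total_degree + 5 * card (nodes G) + 3"
proof -
  let ?r = "(dir G \<union> undir G)\<inverse>"
  let ?succs = "\<lambda>v. foreach (adj v)
    (\<lambda>(e, w) ws. tick (if e = Left \<or> e = Undirected then w # ws else ws)) []"
  obtain P where P: "initial vs S (\<lambda>v. v) = Result (P, set P) (2 * length vs + 1)" "distinct P"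
    "set P = {v. S v}"
  proof -
    have "{v \<in> set vs. S v} = {v. S v}" using assms by (auto simp: nodes_list)
    then show ?thesis using initial_result[OF nodes_list(1) inj_on_id2, of S] that by auto
  qed
  have "\<exists>t. search ?succs (P, set P) = Result (?r\<^sup>* `` set P) t \<and>
      t \<le> (\<Sum>v\<in>nodes G. 4 * length (adj v) + 3) + 2"
  proof (rule search_result)
    fix v assume v: "v \<in> nodes G"
    let ?h = "\<lambda>(e, w). if e = Left \<or> e = Undirected then [w] else []"
    let ?ws = "fold (\<lambda>x ws. ?h x @ ws) (adj v) []"
    have *: "?succs v = Result ?ws (2 * length (adj v) + 1)"
      by (rule foreach_tick) (auto split: prod.split)
    have "length (?h x) \<le> 1" for x by (cases x) simp
    from length_fold_append[OF this, where xs = "adj v" and ys = "[]"] have len: "length ?ws \<le> length (adj v)" by simp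
    have "set ?ws = {w. \<exists>e. joins G v e w \<and> (e = Left \<or> e = Undirected)}"
      by (auto simp: set_fold_append set_adj[OF v] split: if_splits)
    also have "\<dots> = {w. joins G v Left w \<or> joins G v Undirected w}" by blast
    also have "\<dots> = ?r `` {v}"
      using G by (auto simp: mixed_graph_def sym_def)
    finally have "set ?ws = ?r `` {v}" .
    moreover have "?r `` {v} \<subseteq> nodes G" using G unfolding mixed_graph_def by blast
    moreover have bound: "2 * length (adj v) + 1 + 2 * length ?ws + 2 \<le> 4 * length (adj v) + 3" using len by simp
    ultimately show "\<exists>ss t. ?succs v = Result ss t \<and> set ss = ?r `` {v} \<and> set ss \<subseteq> nodes G \<and>
        t + 2 * length ss + 2 \<le> 4 * length (adj v) + 3"
      using * bound by blast
  next
    show "set P \<subseteq> nodes G" unfolding P(3) using assms by blast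
  qed (rule finite_nodes P(2))+
  then obtain t where t: "search ?succs (P, set P) = Result (?r\<^sup>* `` set P) t"
    "t \<le> 4 * total_degree + 3 * card (nodes G) + 2"
    unfolding sum_affine_length by blast
  have "?r\<^sup>* `` set P = {u. \<exists>w. S w \<and> (u, w) \<in> (dir G \<union> undir G)\<^sup>*}"
    unfolding P(3) rtrancl_converse by auto
  with t show ?thesis by (simp add: anteriors_prog_def P(1) nodes_list(3))
qed

lemma test_sep_prog_result:
  assumes X: "X \<subseteq> nodes G"
  shows "\<exists>t. test_sep_prog vs adj X Y Z =
      Result ((test_sep_rel G Z)\<^sup>* `` (Pair Left ` X) \<inter> {s. snd s \<in> Y} = {}) t \<and>
    t \<le> 8 * total_degree + 14 * card (nodes G) + 3"
proof -
  let ?r = "test_sep_rel G Z" and ?F = "{s. snd s \<in> Y}" and ?U = "(UNIV :: edge_type set) \<times> nodes G"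
  let ?I = "Pair Left ` X"
  \<comment> \<open>Scanning the list costs \<open>2 * length (adj v) + 1\<close>, returning the
    triple one step and the loop another.\<close>
  define K where "K = (\<lambda>(e :: edge_type, v). 2 * length (adj v) + 3)"
  \<comment> \<open>Once \<open>res\<close> is false the loop stops early, and only the existence of
    a reached state in \<open>Y\<close> has to be kept.\<close>
  define Inv where "Inv s = (case s of (P, Q, res) \<Rightarrow> distinct P \<and> set P \<subseteq> Q \<and> Q \<subseteq> ?U \<and>
    (if res then search_inv ?r ?I ?F (set P) Q else ?r\<^sup>* `` ?I \<inter> ?F \<noteq> {}))" for s :: "_ \<times> _ \<times> bool"
  define \<Phi> where "\<Phi> s = (case s of (P, Q, res) \<Rightarrow> sum K (set P) + sum K (?U - Q))" for s :: "_ \<times> _ \<times> bool"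
  have fin: "finite ?U" by (intro finite_cartesian_product finite_edge_type finite_nodes)
  let ?b = "\<lambda>(P, Q, res). P \<noteq> [] \<and> res"
  let ?step = "\<lambda>e T (f, N) (P, Q). tick
      (if m_connecting Z e T f \<and> (f, N) \<notin> Q then ((f, N) # P, insert (f, N) Q) else (P, Q))"
  let ?c = "\<lambda>(P, Q, res). case hd P of (e, T) \<Rightarrow> do {
          (P, Q) \<leftarrow> foreach (adj T) (?step e T) (tl P, Q);
          tick (P, Q, T \<notin> Y) }"
  obtain P where P: "initial vs (\<lambda>x. x \<in> X) (Pair Left) = Result (P, set P) (2 * length vs + 1)"
    "distinct P" "set P = ?I"
  proof -
    have eq: "{v \<in> set vs. v \<in> X} = X" using X by (auto simp: nodes_list)
    have "inj (Pair Left)" by (simp add: inj_def)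
    from initial_result[OF nodes_list(1) this, of "\<lambda>x. x \<in> X", unfolded eq] that show ?thesis by blast
  qed
  have "\<exists>s' t. while_timed ?b ?c (P, set P, True) = Result s' t \<and> Inv s' \<and> \<not> ?b s' \<and>
      t + \<Phi> s' \<le> \<Phi> (P, set P, True) + 1"
  proof (rule while_timed_rule)
    show "Inv (P, set P, True)" using P X by (auto simp: Inv_def search_inv_start)
    fix s assume "Inv s" "?b s"
    then obtain e T P' Q where s: "s = ((e, T) # P', Q, True)"
      by (cases s) (auto simp: neq_Nil_conv)
    have inv: "distinct ((e, T) # P')" "Q \<subseteq> ?U" "search_inv ?r ?I ?F (set ((e, T) # P')) Q"
      and sub: "set ((e, T) # P') \<subseteq> Q"
      using \<open>Inv s\<close> by (auto simp: Inv_def s)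
    have T: "T \<in> nodes G" using sub inv by auto
    let ?g = "\<lambda>s (P, Q). if m_connecting Z e T (fst s) \<and> s \<notin> Q then (s # P, insert s Q) else (P, Q)"
    obtain P'' Q'' where *: "fold ?g (adj T) (P', Q) = (P'', Q'')" by (rule prod.exhaust)
    have "foreach (adj T) (?step e T) (P', Q) = Result (P'', Q'') (2 * length (adj T) + 1)"
      unfolding *[symmetric] by (rule foreach_tick) (auto split: prod.split)
    then have c: "?c s = Result (P'', Q'', T \<notin> Y) (2 * length (adj T) + 2)"
      by (simp add: s tick_def)
    have "{s \<in> set (adj T). m_connecting Z e T (fst s)} = ?r `` {(e, T)}"
      using set_adj[OF T] by (auto simp: test_sep_rel_def)
    then have PQ: "distinct P''" "set P'' = set P' \<union> (?r `` {(e, T)} - Q)" "Q'' = Q \<union> ?r `` {(e, T)}"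
      using fold_push[OF _ _ *] inv sub by auto
    have r: "?r `` {(e, T)} \<subseteq> ?U" using joins_nodes[OF G] by (auto simp: test_sep_rel_def)
    have set_P'': "set P'' = set ((e, T) # P') - {(e, T)} \<union> (?r `` {(e, T)} - Q)"
      using PQ(2) inv(1) by auto
    have "Inv (P'', Q'', T \<notin> Y)"
    proof (cases "T \<in> Y")
      case True
      then have "(e, T) \<in> ?r\<^sup>* `` ?I \<inter> ?F" using inv(3) by (auto simp: search_inv_def)
      then have "?r\<^sup>* `` ?I \<inter> ?F \<noteq> {}" by blast
      then show ?thesis using True PQ inv sub r by (auto simp: Inv_def)
    next
      case False
      then have "search_inv ?r ?I ?F (set P'') Q''"
        unfolding set_P'' PQ(3) by (intro search_inv_step[OF inv(3)]) simp_all
      then show ?thesis using False PQ(1,3) inv(2) r by (simp add: Inv_def search_inv_def)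
    qed
    moreover have "\<Phi> (P'', Q'', T \<notin> Y) + K (e, T) = \<Phi> s"
      unfolding \<Phi>_def s prod.case set_P'' PQ(3)
      by (rule worklist_potential[OF fin inv(2) r _ sub]) simp
    ultimately show "\<exists>s' t. ?c s = Result s' t \<and> Inv s' \<and> \<Phi> s' + t < \<Phi> s"
      unfolding c by (auto simp: K_def)
  qed
  then obtain P' Q' res t where w: "while_timed ?b ?c (P, set P, True) = Result (P', Q', res) t"
    "Inv (P', Q', res)" "P' = [] \<or> \<not> res" "t + \<Phi> (P', Q', res) \<le> \<Phi> (P, set P, True) + 1" by auto
  have res: "res \<longleftrightarrow> ?r\<^sup>* `` ?I \<inter> ?F = {}"
  proof (cases res)
    case True
    then have "search_inv ?r ?I ?F {} Q'" using w(2,3) by (simp add: Inv_def)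
    from search_inv_done[OF this] True show ?thesis by simp
  next
    case False
    then show ?thesis using w(2) by (simp add: Inv_def)
  qed
  have "set P \<subseteq> ?U" using P X by auto
  then have "sum K (set P) + sum K (?U - set P) = sum K ?U"
    using fin by (metis add.commute sum.subset_diff)
  also have "\<dots> = (\<Sum>e\<in>(UNIV :: edge_type set). \<Sum>v\<in>nodes G. 2 * length (adj v) + 3)"
    unfolding K_def by (simp only: sum.cartesian_product)
  \<comment> \<open>The states pair every node with each of the four edge types, so the costs 2 and
    3 are multiplied by 4.\<close>
  also have "\<dots> = 8 * total_degree + 12 * card (nodes G)"
    by (simp add: sum_affine_length card_edge_type)
  finally have "t \<le> 8 * total_degree + 12 * card (nodes G) + 1" using w(4) by (simp add: \<Phi>_def)
  with P(1) w(1) res show ?thesis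
    by (simp add: test_sep_prog_def tick_def nodes_list(3))
qed

end

section \<open>Augmented graphs\<close>

lemma induced_simps [simp]:
  "nodes (induced G A) = nodes G \<inter> A"
  "dir (induced G A) = dir G \<inter> A \<times> A"
  "undir (induced G A) = undir G \<inter> A \<times> A"
  "bidir (induced G A) = bidir G \<inter> A \<times> A"
  by (simp_all add: induced_def)

lemma adjacent_induced [simp]:
  "adjacent (induced G A) u v \<longleftrightarrow> adjacent G u v \<and> u \<in> A \<and> v \<in> A"
  by (auto simp: adjacent_def)

lemma arrowhead_induced [simp]:
  "arrowhead (induced G A) u v \<longleftrightarrow> arrowhead G u v \<and> u \<in> A \<and> v \<in> A"
  by (auto simp: arrowhead_def)

lemma mixed_induced: "mixed_graph G \<Longrightarrow> mixed_graph (induced G A)"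
  by (auto simp: mixed_graph_def irrefl_def sym_def)

lemma ancestral_induced:
  assumes "ancestral_graph G"
  shows "ancestral_graph (induced G A)"
proof -
  have G: "mixed_graph G" using assms by (simp add: ancestral_graph_def)
  have "anterior G a b" if "anterior (induced G A) a b" for a b
    using that rtrancl_mono[of "dir (induced G A) \<union> undir (induced G A)" "dir G \<union> undir G"]
    by (auto simp: anterior_iff[OF G] anterior_iff[OF mixed_induced[OF G]])
  with assms show ?thesis
    unfolding ancestral_graph_def by (auto simp: mixed_induced)
qed

text \<open>An edge between two colliders of a path has arrowheads at both ends and is bidirected,
  so a path of colliders is a single edge or a bidirected chain entered by arrowheads from both
  ends. Nodes may repeat here; \<open>c = d\<close> allows a single collider.\<close>

definition aug_adj :: "'v mixed_graph \<Rightarrow> 'v \<Rightarrow> 'v \<Rightarrow> bool" where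
  "aug_adj H u v \<longleftrightarrow> u \<noteq> v \<and>
     (adjacent H u v \<or> (\<exists>c d. arrowhead H u c \<and> (c, d) \<in> (bidir H)\<^sup>* \<and> arrowhead H v d))"

lemma aug_adj_sym:
  assumes "mixed_graph H" "aug_adj H u v"
  shows "aug_adj H v u"
proof -
  have "(bidir H)\<inverse> = bidir H"
    using assms(1) by (auto simp: mixed_graph_def sym_def)
  then have "(c, d) \<in> (bidir H)\<^sup>* \<longleftrightarrow> (d, c) \<in> (bidir H)\<^sup>*" for c d
    by (metis rtrancl_converseD rtrancl_converseI)
  with assms adjacent_sym[OF assms(1)] show ?thesis unfolding aug_adj_def by blast
qed

lemma aug_adj_nodes:
  assumes "mixed_graph H" "aug_adj H u v"
  shows "u \<in> nodes H" "v \<in> nodes H"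
  using assms adjacent_nodes[OF assms(1)] arrowhead_adjacent[OF assms(1)]
  unfolding aug_adj_def by blast+

text \<open>The chain in \<open>aug_adj\<close> may revisit nodes, even \<open>u\<close> and
  \<open>v\<close>; cutting loops with every node admissible as a collider restores a path.\<close>

lemma augmented_edge_iff:
  assumes H: "ancestral_graph H"
  shows "{u, v} \<in> snd (augmented H) \<longleftrightarrow> aug_adj H u v"
proof
  note mixed = ancestral_imp_mixed[OF H]
  assume "{u, v} \<in> snd (augmented H)"
  then obtain u' v' p where uv: "{u, v} = {u', v'}" "u' \<noteq> v'" and p: "path H p" "hd p = u'" "last p = v'"
    and col: "\<And>i. 0 < i \<Longrightarrow> Suc i < length p \<Longrightarrow> collider H p i"
    by (auto simp: augmented_def)
  have ne: "p \<noteq> []" using p by (simp add: path_def)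
  then have ends: "p ! 0 = u'" "p ! (length p - 1) = v'"
    using p by (simp_all add: hd_conv_nth last_conv_nth)
  then have len: "1 < length p" using uv(2) by (cases "length p = 1") (use ne in \<open>auto simp: Suc_lessI\<close>)
  have "aug_adj H u' v'"
  proof (cases "length p = 2")
    case True
    then have "adjacent H u' v'" using path_nth_adjacent[OF H p(1), of 0] ends by simp
    then show ?thesis using uv by (simp add: aug_adj_def)
  next
    case False
    with len have len: "2 < length p" by simp
    have "(p ! 1, p ! i) \<in> (bidir H)\<^sup>*" if "1 \<le> i" "Suc i < length p" for i
      using that
    proof (induction i rule: dec_induct)
      case (step i)
      then have "(p ! i, p ! Suc i) \<in> bidir H"
        using col[of i] col[of "Suc i"] both_arrowheads[OF H] by (auto simp: collider_def)
      with step show ?case by (meson Suc_lessD rtrancl.rtrancl_into_rtrancl)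
    qed simp
    from this[of "length p - 2"] have "(p ! 1, p ! (length p - 2)) \<in> (bidir H)\<^sup>*"
      using len by simp
    moreover have "arrowhead H u' (p ! 1)" using col[of 1] len ends by (simp add: collider_def)
    moreover have "arrowhead H v' (p ! (length p - 2))"
      using col[of "length p - 2"] len ends by (simp add: collider_def Suc_diff_Suc numeral_2_eq_2)
    ultimately show ?thesis using uv unfolding aug_adj_def by blast
  qed
  then show "aug_adj H u v" using uv(1) aug_adj_sym[OF mixed] by (auto simp: doubleton_eq_iff)
next
  note mixed = ancestral_imp_mixed[OF H]
  assume uv: "aug_adj H u v"
  text \<open>With \<open>Z\<close> the complement of \<open>u\<close>, only \<open>u\<close> itself can be a non-collider.\<close>
  let ?walk = "walk_to H (- {u}) UNIV {u}"
  have start: "?walk (arrowhead H u w) w" if "adjacent H u w" for w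
    by (rule walk_to.step[OF walk_to.start that]) simp_all
  have "\<exists>h. ?walk h v"
  proof (cases "adjacent H u v")
    case True
    then show ?thesis using start by blast
  next
    case False
    with uv obtain c d where cd: "arrowhead H u c" "(c, d) \<in> (bidir H)\<^sup>*" "arrowhead H v d"
      unfolding aug_adj_def by blast
    have "?walk True d"
      using cd(2)
    proof (induction rule: rtrancl_induct)
      case base
      then show ?case using start[OF arrowhead_adjacent[OF mixed cd(1)]] cd(1) by simp
    next
      case (step d e)
      then have "adjacent H d e" "arrowhead H e d" "arrowhead H d e"
        using bidir_sym[OF mixed] by (auto simp: adjacent_def arrowhead_def)
      then show ?case using walk_to.step[OF step.IH, of e] by simp
    qed
    moreover have "adjacent H d v" using cd(3) arrowhead_adjacent[OF mixed] adjacent_sym[OF mixed] by blast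
    ultimately show ?thesis using walk_to.step[of H "- {u}" UNIV "{u}" True d v] cd(3) by auto
  qed
  then obtain h where h: "?walk h v" ..
  have "{u} \<subseteq> nodes H" using aug_adj_nodes(1)[OF mixed uv] by simp
  from walk_to_imp_open_path[OF H _ this h]
  obtain p where p: "open_path H (- {u}) UNIV p" "hd p = u" "last p = v" by auto
  then have path: "path H p" by (simp add: open_path_def)
  have "collider H p i" if i: "0 < i" "Suc i < length p" for i
  proof (rule ccontr)
    assume "\<not> collider H p i"
    then have "p ! i = u" using p(1) i by (auto simp: open_path_def)
    then have "p ! i = p ! 0" using p(2) i by (cases p) auto
    then show False using path i nth_eq_iff_index_eq[of p i 0] by (auto simp: path_def)
  qed
  moreover have "u \<noteq> v" using uv by (simp add: aug_adj_def)
  ultimately show "{u, v} \<in> snd (augmented H)"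
    unfolding augmented_def snd_conv using path p(2,3) by blast
qed

section \<open>Reachability in the augmented graph\<close>

text \<open>A walk of this relation that starts outside \<open>M\<close> avoids \<open>M\<close> and
  meets \<open>Z\<close> at most in its last node, which is what \<open>reached\<close> asks of a
  path.\<close>

definition aug_rel :: "'v mixed_graph \<Rightarrow> 'v set \<Rightarrow> 'v set \<Rightarrow> 'v rel" where
  "aug_rel H Z M = {(u, v). aug_adj H u v \<and> u \<notin> Z \<and> v \<notin> M}"

fun aug_step :: "'v mixed_graph \<Rightarrow> 'v set \<Rightarrow> 'v set \<Rightarrow> 'v search_state \<Rightarrow> 'v search_state \<Rightarrow> bool" where
  "aug_step H Z M (At v) (At w) \<longleftrightarrow> adjacent H v w \<and> v \<notin> Z \<and> w \<notin> M"
| "aug_step H Z M (At v) (Via w) \<longleftrightarrow> arrowhead H v w \<and> v \<notin> Z"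
| "aug_step H Z M (Via c) (At w) \<longleftrightarrow> arrowhead H w c \<and> w \<notin> M"
| "aug_step H Z M (Via c) (Via w) \<longleftrightarrow> (c, w) \<in> bidir H"

definition aug_search_rel :: "'v mixed_graph \<Rightarrow> 'v set \<Rightarrow> 'v set \<Rightarrow> 'v search_state rel" where
  "aug_search_rel H Z M = {(s, t). aug_step H Z M s t}"

lemma aug_search_rel_iff:
  assumes H: "mixed_graph H"
  shows "(At x, At w) \<in> (aug_search_rel H Z M)\<^sup>* \<longleftrightarrow> (x, w) \<in> (aug_rel H Z M)\<^sup>*"
proof
  \<comment> \<open>\<open>Via d\<close> stands for an unfinished edge of the augmented graph: the
    search has left \<open>u\<close> and followed a bidirected chain up to \<open>d\<close>.\<close>
  have "case t of At w \<Rightarrow> (x, w) \<in> (aug_rel H Z M)\<^sup>*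
      | Via d \<Rightarrow> \<exists>u c. (x, u) \<in> (aug_rel H Z M)\<^sup>* \<and> u \<notin> Z \<and> arrowhead H u c \<and> (c, d) \<in> (bidir H)\<^sup>*"
    if "(At x, t) \<in> (aug_search_rel H Z M)\<^sup>*" for t
    using that
  proof (induction rule: rtrancl_induct)
    case (step s t)
    then have st: "aug_step H Z M s t" by (simp add: aug_search_rel_def)
    show ?case
    proof (cases s)
      case s: (At v)
      then have x: "(x, v) \<in> (aug_rel H Z M)\<^sup>*" using step.IH by simp
      show ?thesis
      proof (cases t)
        case (At w)
        then have "(v, w) \<in> aug_rel H Z M"
          using st s adjacent_irrefl[OF H] by (auto simp: aug_rel_def aug_adj_def)
        with x At show ?thesis by auto
      next
        case (Via w)
        then show ?thesis using x st s by auto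
      qed
    next
      case s: (Via d)
      then obtain u c where u: "(x, u) \<in> (aug_rel H Z M)\<^sup>*" "u \<notin> Z" "arrowhead H u c" "(c, d) \<in> (bidir H)\<^sup>*"
        using step.IH by auto
      show ?thesis
      proof (cases t)
        case (At w)
        \<comment> \<open>The search may return to the node \<open>u\<close> that it left, which is
          no edge of the augmented graph; the position is then unchanged.\<close>
        then have "u = w \<or> (u, w) \<in> aug_rel H Z M"
          using st s u unfolding aug_rel_def aug_adj_def by auto
        with u(1) At show ?thesis by auto
      next
        case (Via w)
        then have "(c, w) \<in> (bidir H)\<^sup>*" using st s u(4) by auto
        then show ?thesis using Via u by auto
      qed
    qed
  qed simp
  from this[of "At w"] show "(At x, At w) \<in> (aug_search_rel H Z M)\<^sup>* \<Longrightarrow> (x, w) \<in> (aug_rel H Z M)\<^sup>*"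
    by simp
next
  assume "(x, w) \<in> (aug_rel H Z M)\<^sup>*"
  then show "(At x, At w) \<in> (aug_search_rel H Z M)\<^sup>*"
  proof (induction rule: rtrancl_induct)
    case (step u v)
    then have uv: "aug_adj H u v" "u \<notin> Z" "v \<notin> M" by (auto simp: aug_rel_def)
    have "(At u, At v) \<in> (aug_search_rel H Z M)\<^sup>*"
    proof (cases "adjacent H u v")
      case True
      then have "(At u, At v) \<in> aug_search_rel H Z M" using uv by (simp add: aug_search_rel_def)
      then show ?thesis by blast
    next
      case False
      then obtain c d where cd: "arrowhead H u c" "(c, d) \<in> (bidir H)\<^sup>*" "arrowhead H v d"
        using uv(1) unfolding aug_adj_def by blast
      have "(At u, Via c) \<in> aug_search_rel H Z M" using cd(1) uv by (simp add: aug_search_rel_def)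
      moreover have "(Via c, Via d) \<in> (aug_search_rel H Z M)\<^sup>*"
        using cd(2)
      proof (induction rule: rtrancl_induct)
        case (step d e)
        then have "(Via d, Via e) \<in> aug_search_rel H Z M" by (simp add: aug_search_rel_def)
        with step.IH show ?case by (rule rtrancl_into_rtrancl)
      qed simp
      moreover have "(Via d, At v) \<in> aug_search_rel H Z M" using cd(3) uv by (simp add: aug_search_rel_def)
      ultimately show ?thesis
        by (meson converse_rtrancl_into_rtrancl rtrancl_into_rtrancl)
    qed
    with step.IH show ?case by (rule rtrancl_trans)
  qed simp
qed

lemma reached_eq:
  assumes H: "ancestral_graph H" and S: "S \<subseteq> nodes H" "S \<inter> M = {}" and M: "M \<subseteq> Z"
  shows "reached (delete_nodes M (augmented H)) S Z = {v \<in> Z. \<exists>x\<in>S. (x, v) \<in> (aug_rel H Z M)\<^sup>*}"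
proof -
  let ?H = "delete_nodes M (augmented H)" and ?r = "\<lambda>u v. (u, v) \<in> aug_rel H Z M"
  have edge: "{u, v} \<in> snd ?H \<longleftrightarrow> aug_adj H u v \<and> u \<notin> M \<and> v \<notin> M" for u v
    by (auto simp: delete_nodes_def augmented_edge_iff[OF H])
  have nodes: "fst ?H = nodes H - M" by (simp add: delete_nodes_def augmented_def)
  have "(\<exists>p. upath ?H p \<and> hd p = x \<and> last p = v \<and> set p \<inter> (Z - {v}) = {}) \<longleftrightarrow> (x, v) \<in> (aug_rel H Z M)\<^sup>*"
    if x: "x \<in> S" for x v
  proof
    assume "\<exists>p. upath ?H p \<and> hd p = x \<and> last p = v \<and> set p \<inter> (Z - {v}) = {}"
    then obtain p where p: "upath ?H p" "hd p = x" "last p = v" "set p \<inter> (Z - {v}) = {}" by blast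
    have ne: "p \<noteq> []" "distinct p" using p(1) by (auto simp: upath_def)
    have "successively ?r p"
      unfolding successively_conv_nth
    proof clarify
      fix i assume i: "Suc i < length p"
      \<comment> \<open>\<open>v\<close> is the last node of a list without repetitions, so no
        earlier node shares its permission to lie in \<open>Z\<close>.\<close>
      have "p ! i \<noteq> v"
        using ne i p(3) nth_eq_iff_index_eq[of p i "length p - 1"] by (auto simp: last_conv_nth)
      then have "p ! i \<notin> Z" using p(4) nth_mem[OF Suc_lessD[OF i]] by blast
      moreover have "{p ! i, p ! Suc i} \<in> snd ?H"
        using p(1) i by (auto simp: upath_def successively_conv_nth)
      ultimately show "(p ! i, p ! Suc i) \<in> aug_rel H Z M" by (auto simp: edge aug_rel_def)
    qed
    from successively_imp_rtranclp[OF ne(1) this] p show "(x, v) \<in> (aug_rel H Z M)\<^sup>*"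
      by (simp add: rtranclp_rtrancl_eq)
  next
    assume "(x, v) \<in> (aug_rel H Z M)\<^sup>*"
    then have "?r\<^sup>*\<^sup>* x v" by (simp add: rtranclp_rtrancl_eq)
    then obtain p where p: "p \<noteq> []" "distinct p" "successively ?r p" "hd p = x" "last p = v"
      using rtranclp_distinct_path by metis
    have "set p \<subseteq> nodes H - M"
      by (rule successively_subset[OF p(1,3)])
        (use p(4) x S aug_adj_nodes(2)[OF ancestral_imp_mixed[OF H]] in \<open>auto simp: aug_rel_def\<close>)
    moreover have "successively (\<lambda>u v. {u, v} \<in> snd ?H) p"
      by (rule successively_mono[OF p(3)]) (use M in \<open>auto simp: edge aug_rel_def\<close>)
    ultimately have "upath ?H p" using p by (simp add: upath_def nodes)
    moreover have "set p \<inter> (Z - {v}) = {}"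
    proof -
      have "p ! i \<notin> Z - {v}" if "i < length p" for i
      proof (cases "Suc i < length p")
        case True
        then have "(p ! i, p ! Suc i) \<in> aug_rel H Z M"
          using p(3) by (simp add: successively_conv_nth)
        then show ?thesis by (simp add: aug_rel_def)
      next
        case False
        with that have "i = length p - 1" by simp
        then show ?thesis using p(1,5) by (simp add: last_conv_nth)
      qed
      then show ?thesis by (auto simp: in_set_conv_nth)
    qed
    ultimately show "\<exists>p. upath ?H p \<and> hd p = x \<and> last p = v \<and> set p \<inter> (Z - {v}) = {}"
      using p by blast
  qed
  then show ?thesis unfolding reached_def by blast
qed

text \<open>Every node but the last is left and hence outside \<open>Z\<close>, and the last one is
  so by assumption; as \<open>M\<close> is part of \<open>Z\<close>, every step can be
  reversed.\<close>

lemma aug_rel_converse: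
  assumes H: "mixed_graph H" and xv: "(x, v) \<in> (aug_rel H Z M)\<^sup>*" and v: "v \<notin> Z" and M: "M \<subseteq> Z"
  shows "(v, x) \<in> (aug_rel H Z M)\<^sup>*"
  using xv
proof (induction rule: converse_rtrancl_induct)
  case (step x a)
  have "a \<notin> Z" using step.hyps(2) v by (cases rule: converse_rtranclE) (auto simp: aug_rel_def)
  then have "(a, x) \<in> aug_rel H Z M"
    using step.hyps(1) aug_adj_sym[OF H] M by (auto simp: aug_rel_def)
  with step.IH show ?case by (rule rtrancl_into_rtrancl)
qed simp

section \<open>m-separation as reachability\<close>

text \<open>The initial pair \<open>(Left, x)\<close> is a fictitious edge without an arrowhead at
  \<open>x\<close>, matching the flag \<open>False\<close> at the start of a walk. A continuation
  depends on the entering edge type only through the mark at its end, hence the existential.\<close>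

lemma test_sep_rel_iff_walk_to:
  assumes G: "ancestral_graph G"
  shows "walk_to G Z Z X h v \<longleftrightarrow> (\<exists>e. head_at_end e = h \<and> (e, v) \<in> (test_sep_rel G Z)\<^sup>* `` (Pair Left ` X))"
proof
  assume "walk_to G Z Z X h v"
  then show "\<exists>e. head_at_end e = h \<and> (e, v) \<in> (test_sep_rel G Z)\<^sup>* `` (Pair Left ` X)"
  proof (induction rule: walk_to.induct)
    case (start x)
    then show ?case by (intro exI[of _ Left]) (auto simp: head_at_end_def)
  next
    case (step h v w)
    then obtain e x where e: "head_at_end e = h" "x \<in> X" "((Left, x), (e, v)) \<in> (test_sep_rel G Z)\<^sup>*" by auto
    obtain f where f: "joins G v f w" using step.hyps(2) adjacent_iff_joins[OF G] by blast
    have "((e, v), (f, w)) \<in> test_sep_rel G Z"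
      using step.hyps(3) f joins_head[OF G f] e(1)
      by (auto simp: test_sep_rel_def m_connecting_def split: if_splits)
    with e have "(f, w) \<in> (test_sep_rel G Z)\<^sup>* `` (Pair Left ` X)"
      by (meson ImageI imageI rtrancl_into_rtrancl)
    then show ?case using joins_head(1)[OF G f] by blast
  qed
next
  assume "\<exists>e. head_at_end e = h \<and> (e, v) \<in> (test_sep_rel G Z)\<^sup>* `` (Pair Left ` X)"
  then obtain e x where e: "head_at_end e = h" "x \<in> X" "((Left, x), (e, v)) \<in> (test_sep_rel G Z)\<^sup>*" by blast
  have "walk_to G Z Z X (head_at_end (fst s)) (snd s)" if "((Left, x), s) \<in> (test_sep_rel G Z)\<^sup>*" for s
    using that
  proof (induction rule: rtrancl_induct)
    case base
    then show ?case using e(2) by (simp add: head_at_end_def walk_to.start)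
  next
    case (step s t)
    obtain e v f w where s: "s = (e, v)" "t = (f, w)" by (metis surj_pair)
    then have f: "joins G v f w" and m: "m_connecting Z e v f"
      using step.hyps(2) by (auto simp: test_sep_rel_def)
    have "walk_to G Z Z X (arrowhead G v w) w"
    proof (rule walk_to.step)
      show "walk_to G Z Z X (head_at_end e) v" using step.IH s by simp
      show "adjacent G v w" using f adjacent_iff_joins[OF G] by blast
      show "if head_at_end e \<and> arrowhead G w v then v \<in> Z else v \<notin> Z"
        using m joins_head(2)[OF G f] by (auto simp: m_connecting_def)
    qed
    then show ?case using s joins_head(1)[OF G f] by simp
  qed
  from this[OF e(3)] e(1) show "walk_to G Z Z X h v" by simp
qed

context
  fixes G :: "'v mixed_graph" and X Y Z M
  assumes G: "ancestral_graph G" and XY: "X \<subseteq> nodes G" "Y \<subseteq> nodes G"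
    and Z: "Z \<subseteq> nodes G - (X \<union> Y)" and M: "M \<subseteq> Z"
begin

abbreviation (input) region :: "'v set" where
  "region \<equiv> Ant G (X \<union> Y \<union> M)"

lemma m_separator_iff_walk_to:
  "m_separator G X Y Z \<longleftrightarrow> \<not> (\<exists>y\<in>Y. \<exists>h. walk_to G Z (An G Z) X h y)"
  using m_connected_iff_walk_to[OF G XY(1)] Z unfolding m_separator_def by blast

lemma m_separator_iff_test_sep:
  "m_separator G X Y Z \<longleftrightarrow> (test_sep_rel G Z)\<^sup>* `` (Pair Left ` X) \<inter> {s. snd s \<in> Y} = {}"
proof -
  have ZG: "Z \<subseteq> nodes G" using Z by blast
  have "m_separator G X Y Z \<longleftrightarrow> \<not> (\<exists>y\<in>Y. \<exists>e. (e, y) \<in> (test_sep_rel G Z)\<^sup>* `` (Pair Left ` X))"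
    unfolding m_separator_iff_walk_to walk_to_An_iff[OF G XY(1) ZG]
      test_sep_rel_iff_walk_to[OF G] by blast
  also have "\<dots> \<longleftrightarrow> (test_sep_rel G Z)\<^sup>* `` (Pair Left ` X) \<inter> {s. snd s \<in> Y} = {}" by force
  finally show ?thesis .
qed

text \<open>An open path is translated position by position, a collider to a \<open>Via\<close>
  state and any other node to an \<open>At\<close> state; it stays in the region because
  \<open>X\<close>, \<open>Y\<close> and \<open>Z\<close> do. Conversely, a search yields a walk
  whose colliders are only known to be anteriors, which \<open>walk_to_Ant\<close> repairs.\<close>

lemma m_separator_iff_aug:
  assumes ZA: "Z \<subseteq> region"
  shows "m_separator G X Y Z \<longleftrightarrow> \<not> (\<exists>x\<in>X. \<exists>y\<in>Y. (x, y) \<in> (aug_rel (induced G region) Z M)\<^sup>*)"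
proof -
  note mixed = ancestral_imp_mixed[OF G]
  let ?H = "induced G region"
  let ?r = "aug_search_rel ?H Z M"
  have sub: "X \<union> Y \<subseteq> region"
    using subset_Ant[OF mixed, of "X \<union> Y"] XY Ant_mono[of "X \<union> Y" "X \<union> Y \<union> M" G] by blast
  have to_aug: "(At x, At y) \<in> ?r\<^sup>*" if con: "m_connected G Z x y" and xy: "x \<in> X" "y \<in> Y" for x y
  proof -
    have y: "y \<notin> Z" using xy Z by blast
    obtain p where p: "open_path G Z (An G Z) p" "hd p = x" "last p = y"
      using con m_connected_iff_open_path[OF G y] by blast
    have "set p \<subseteq> Ant G ({x, y} \<union> Z)" using open_path_subset_Ant[OF G p(1)] p(2,3) y by simp
    also have "\<dots> \<subseteq> Ant G region" using sub ZA xy by (intro Ant_mono) blast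
    also have "\<dots> \<subseteq> region" by (rule Ant_Ant[OF mixed])
    finally have pA: "p ! i \<in> region" if "i < length p" for i using that nth_mem by blast
    have ne: "p \<noteq> []" using p(1) by (auto simp: open_path_def path_def)
    have nonc: "p ! i \<notin> Z" if "i < length p" "\<not> collider G p i" for i
    proof (cases "Suc i < length p")
      case True
      then show ?thesis using p(1) that by (auto simp: open_path_def)
    next
      case False
      with that have "i = length p - 1" by simp
      then show ?thesis using p(3) y ne by (simp add: last_conv_nth)
    qed
    have "(At x, if collider G p i then Via (p ! i) else At (p ! i)) \<in> ?r\<^sup>*" if "i < length p" for i
      using that
    proof (induction i)
      case 0
      then show ?case using p(2) ne by (simp add: collider_def hd_conv_nth)
    next
      case (Suc i)
      let ?state = "\<lambda>i. if collider G p i then Via (p ! i) else At (p ! i)"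
      have A: "p ! i \<in> region" "p ! Suc i \<in> region" using Suc.prems pA by simp_all
      have adj: "adjacent G (p ! i) (p ! Suc i)"
        using p(1) Suc.prems path_nth_adjacent[OF G] by (auto simp: open_path_def)
      have "arrowhead G (p ! i) (p ! Suc i)" if "collider G p (Suc i)"
        using that by (simp add: collider_def)
      moreover have "arrowhead G (p ! Suc i) (p ! i)" if "collider G p i"
        using that by (simp add: collider_def)
      moreover have "p ! i \<notin> Z" if "\<not> collider G p i" using nonc that Suc.prems by simp
      moreover have "p ! Suc i \<notin> M" if "\<not> collider G p (Suc i)" using nonc that Suc.prems M by blast
      ultimately have "aug_step ?H Z M (?state i) (?state (Suc i))"
        using A adj both_arrowheads[OF G] by auto
      then have "(?state i, ?state (Suc i)) \<in> ?r" by (simp add: aug_search_rel_def)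
      moreover have "(At x, ?state i) \<in> ?r\<^sup>*" using Suc by simp
      ultimately show ?case by (rule rtrancl_into_rtrancl[rotated])
    qed
    from this[of "length p - 1"] show ?thesis using ne p(3) by (simp add: collider_def last_conv_nth)
  qed
  have from_aug: "\<exists>h. \<exists>y\<in>Y. walk_to G Z (An G Z) X h y" if r: "(At x, At y) \<in> ?r\<^sup>*" and xy: "x \<in> X" "y \<in> Y" for x y
  proof -
    \<comment> \<open>The mark on arrival at an \<open>At\<close> node is left open: the node lies
      in the region and, if it is left again, outside \<open>Z\<close>, so it may be passed as a
      collider or as a non-collider.\<close>
    have "case s of At v \<Rightarrow> v \<in> region \<and> (\<exists>h. walk_to G Z region X h v)
        | Via c \<Rightarrow> c \<in> region \<and> walk_to G Z region X True c" if "(At x, s) \<in> ?r\<^sup>*" for s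
      using that
    proof (induction rule: rtrancl_induct)
      case base
      then show ?case using xy sub by (auto intro: walk_to.start)
    next
      case (step s t)
      then have st: "aug_step ?H Z M s t" by (simp add: aug_search_rel_def)
      have move: "walk_to G Z region X (arrowhead G v w) w"
        if "walk_to G Z region X h v" "adjacent G v w" "v \<in> region" "v \<in> Z \<Longrightarrow> h \<and> arrowhead G w v" for h v w
        by (rule walk_to.step[OF that(1,2)]) (use that(3,4) in auto)
      note adj = arrowhead_adjacent[OF mixed] adjacent_sym[OF mixed]
      show ?case
      proof (cases s)
        case s: (At v)
        then obtain h where h: "walk_to G Z region X h v" "v \<in> region" using step.IH by auto
        show ?thesis
        proof (cases t)
          case (At w)
          then show ?thesis using move[OF h(1) _ h(2), of w] st s by auto
        next
          case (Via w)
          then show ?thesis using move[OF h(1) _ h(2), of w] st s adj(1) by auto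
        qed
      next
        case s: (Via c)
        then have c: "walk_to G Z region X True c" "c \<in> region" using step.IH by auto
        show ?thesis
        proof (cases t)
          case (At w)
          then have "arrowhead G w c" "w \<in> region" using st s by auto
          then have "adjacent G c w" using adj by blast
          then show ?thesis
            using move[OF c(1) _ c(2), of w] At \<open>arrowhead G w c\<close> \<open>w \<in> region\<close> by auto
        next
          case (Via w)
          then have "arrowhead G c w" "arrowhead G w c" "w \<in> region"
            using st s bidir_sym[OF mixed, of c w] by (auto simp: arrowhead_def)
          then show ?thesis using move[OF c(1) _ c(2), of w] Via adj(1) by auto
        qed
      qed
    qed
    from this[OF r] obtain h where "walk_to G Z region X h y" by auto
    moreover have "region \<subseteq> Ant G (X \<union> Y \<union> Z)" using M by (intro Ant_mono) blast
    ultimately show ?thesis using walk_to_Ant[OF G _ xy(2)] Z by blast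
  qed
  show ?thesis
    unfolding aug_search_rel_iff[OF mixed_induced[OF mixed], symmetric]
  proof
    assume "m_separator G X Y Z"
    then show "\<not> (\<exists>x\<in>X. \<exists>y\<in>Y. (At x, At y) \<in> ?r\<^sup>*)"
      unfolding m_separator_iff_walk_to using from_aug by blast
  next
    assume "\<not> (\<exists>x\<in>X. \<exists>y\<in>Y. (At x, At y) \<in> ?r\<^sup>*)"
    then show "m_separator G X Y Z" unfolding m_separator_def using to_aug by blast
  qed
qed

text \<open>Discarding the nodes of \<open>Z\<close> outside the anterior set keeps \<open>Z\<close> a separator: the nodes of a
  path connecting \<open>X\<close> and \<open>Y\<close> given the rest lie in the anterior set.\<close>

lemma minimal_m_separator_subset:
  assumes min: "minimal_m_separator G M X Y Z"
  shows "Z \<subseteq> region"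
proof (rule ccontr)
  note mixed = ancestral_imp_mixed[OF G]
  let ?Z = "Z \<inter> region"
  assume "\<not> Z \<subseteq> region"
  moreover have MA: "M \<subseteq> region"
    using subset_Ant[OF mixed, of M] M Z Ant_mono[of M "X \<union> Y \<union> M" G] by blast
  ultimately have "\<not> m_separator G X Y ?Z"
    using min M unfolding minimal_m_separator_def by blast
  then obtain x y where xy: "x \<in> X" "y \<in> Y" "m_connected G ?Z x y" by (auto simp: m_separator_def)
  have y: "y \<notin> Z" using xy(2) Z by blast
  then obtain p where p: "open_path G ?Z (An G ?Z) p" "hd p = x" "last p = y"
    using xy(3) m_connected_iff_open_path[OF G, of y ?Z x] by auto
  have sub: "X \<union> Y \<subseteq> region"
    using subset_Ant[OF mixed, of "X \<union> Y"] XY Ant_mono[of "X \<union> Y" "X \<union> Y \<union> M" G] by blast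
  have "set p \<subseteq> Ant G ({x, y} \<union> ?Z)" using open_path_subset_Ant[OF G p(1)] p(2,3) y by simp
  also have "\<dots> \<subseteq> Ant G region" using sub xy(1,2) by (intro Ant_mono) blast
  also have "\<dots> \<subseteq> region" by (rule Ant_Ant[OF mixed])
  finally have "p ! i \<in> region" if "i < length p" for i using that nth_mem by blast
  \<comment> \<open>\<open>Z\<close> and its restriction to the region agree on the nodes of
    \<open>p\<close>, and \<open>An\<close> grows with its argument.\<close>
  then have "open_path G Z (An G Z) p"
    using p(1) An_mono[of ?Z Z G] unfolding open_path_def by (auto split: if_splits)
  then have "m_connected G Z x y" using m_connected_iff_open_path[OF G y] p by blast
  then show False using min xy(1,2) unfolding minimal_m_separator_def m_separator_def by blast
qed

end

section \<open>Minimality as reachability from both sides\<close>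

text \<open>A route opened by dropping \<open>v\<close> must visit \<open>v\<close>, which yields
  one part from \<open>X\<close> and one from \<open>Y\<close>; conversely, two such parts join to a
  route as soon as \<open>v\<close> is dropped.\<close>

lemma minimal_m_separator_iff:
  assumes G: "ancestral_graph G" and XY: "X \<subseteq> nodes G" "Y \<subseteq> nodes G"
    and Z: "Z \<subseteq> nodes G - (X \<union> Y)" and M: "M \<subseteq> Z" and A: "Z \<subseteq> Ant G (X \<union> Y \<union> M)"
    and sep: "m_separator G X Y Z"
  defines "r \<equiv> aug_rel (induced G (Ant G (X \<union> Y \<union> M))) Z M"
  shows "minimal_m_separator G M X Y Z \<longleftrightarrow>
    Z - M = {v \<in> Z. \<exists>x\<in>X. (x, v) \<in> r\<^sup>*} \<and> Z - M = {v \<in> Z. \<exists>y\<in>Y. (y, v) \<in> r\<^sup>*}"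
proof -
  let ?H = "induced G (Ant G (X \<union> Y \<union> M))"
  let ?r = "\<lambda>Z. aug_rel ?H Z M"
  have H: "mixed_graph ?H" using mixed_induced[OF ancestral_imp_mixed[OF G]] .
  \<comment> \<open>The graph is built from \<open>M\<close> and not from \<open>Z'\<close>, so one
    graph serves all candidates between \<open>M\<close> and \<open>Z\<close>.\<close>
  have sep_iff: "m_separator G X Y Z' \<longleftrightarrow> \<not> (\<exists>x\<in>X. \<exists>y\<in>Y. (x, y) \<in> (?r Z')\<^sup>*)"
    if "M \<subseteq> Z'" "Z' \<subseteq> Z" for Z'
    using m_separator_iff_aug[OF G XY, of Z' M] that Z A by blast
  have "v \<notin> M" if "x \<notin> M" "(x, v) \<in> r\<^sup>*" for x v
    using that(2,1) by (induction rule: rtrancl_induct) (auto simp: r_def aug_rel_def)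
  then have not_M: "v \<notin> M" if "x \<in> X \<union> Y" "(x, v) \<in> r\<^sup>*" for x v using that M Z by blast
  \<comment> \<open>Up to its first visit of \<open>v\<close> the walk also obeys the relation for
    \<open>Z\<close>; if it never leaves \<open>v\<close>, it obeys it throughout.\<close>
  have via: "(x, b) \<in> r\<^sup>* \<or> (x, v) \<in> r\<^sup>*" if "(x, b) \<in> (?r (Z - {v}))\<^sup>*" for x v b
    using that
  proof (induction rule: rtrancl_induct)
    case (step a b)
    then have "(a, b) \<in> r \<or> a = v" by (auto simp: r_def aug_rel_def)
    with step.IH show ?case by (auto intro: rtrancl_into_rtrancl)
  qed simp
  show ?thesis
  proof (intro iffI)
    assume min: "minimal_m_separator G M X Y Z"
    have "(\<exists>x\<in>X. (x, v) \<in> r\<^sup>*) \<and> (\<exists>y\<in>Y. (y, v) \<in> r\<^sup>*)" if v: "v \<in> Z - M" for v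
    proof -
      have "M \<subseteq> Z - {v}" "Z - {v} \<subset> Z" using v M by blast+
      then have "\<not> m_separator G X Y (Z - {v})" using min unfolding minimal_m_separator_def by blast
      then obtain x y where xy: "x \<in> X" "y \<in> Y" "(x, y) \<in> (?r (Z - {v}))\<^sup>*"
        using sep_iff[of "Z - {v}"] \<open>M \<subseteq> Z - {v}\<close> by blast
      have "y \<notin> Z" "x \<notin> Z" using xy Z by blast+
      then have yx: "(y, x) \<in> (?r (Z - {v}))\<^sup>*"
        using aug_rel_converse[OF H xy(3) _ \<open>M \<subseteq> Z - {v}\<close>] by blast
      have no: "(x, y) \<notin> r\<^sup>*" using sep_iff[OF M] sep xy(1,2) unfolding r_def by blast
      then have "(y, x) \<notin> r\<^sup>*" using aug_rel_converse[OF H _ \<open>x \<notin> Z\<close> M] unfolding r_def by blast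
      \<comment> \<open>In \<open>r\<close> neither \<open>x\<close> reaches \<open>y\<close> nor
        \<open>y\<close> reaches \<open>x\<close>, so the route and its reversal both have to visit
        \<open>v\<close>.\<close>
      then show ?thesis using via[OF xy(3)] via[OF yx] no xy(1,2) by blast
    qed
    then show "Z - M = {v \<in> Z. \<exists>x\<in>X. (x, v) \<in> r\<^sup>*} \<and> Z - M = {v \<in> Z. \<exists>y\<in>Y. (y, v) \<in> r\<^sup>*}"
      using not_M by blast
  next
    assume reach: "Z - M = {v \<in> Z. \<exists>x\<in>X. (x, v) \<in> r\<^sup>*} \<and> Z - M = {v \<in> Z. \<exists>y\<in>Y. (y, v) \<in> r\<^sup>*}"
    have "\<not> m_separator G X Y Z'" if Z': "Z' \<subset> Z" "M \<subseteq> Z'" for Z'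
    proof -
      obtain v where v: "v \<in> Z - M" "v \<notin> Z'" using Z' by blast
      then obtain x y where xy: "x \<in> X" "y \<in> Y" "(x, v) \<in> r\<^sup>*" "(y, v) \<in> r\<^sup>*" using reach by blast
      have "r \<subseteq> ?r Z'" using Z' by (auto simp: r_def aug_rel_def)
      then have r': "(x, v) \<in> (?r Z')\<^sup>*" "(y, v) \<in> (?r Z')\<^sup>*" using xy rtrancl_mono by blast+
      \<comment> \<open>\<open>v\<close> lies outside \<open>Z'\<close>, so the walk from
        \<open>y\<close> to \<open>v\<close> can be reversed and appended.\<close>
      have "(x, y) \<in> (?r Z')\<^sup>*"
        using r'(1) aug_rel_converse[OF H r'(2) v(2) Z'(2)] by (rule rtrancl_trans)
      then show ?thesis using sep_iff[OF Z'(2)] Z'(1) xy(1,2) by blast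
    qed
    then show "minimal_m_separator G M X Y Z"
      using M sep unfolding minimal_m_separator_def by blast
  qed
qed

section \<open>Testing minimality\<close>

lemma foreach_conj:
  "foreach vs (\<lambda>v b. tick (b \<and> P v)) True = Result (\<forall>v\<in>set vs. P v) (2 * length vs + 1)"
proof -
  have "fold (\<lambda>v b. b \<and> P v) vs b \<longleftrightarrow> b \<and> (\<forall>v\<in>set vs. P v)" for b
    by (induction vs arbitrary: b) auto
  moreover have "foreach vs (\<lambda>v b. tick (b \<and> P v)) True =
      Result (fold (\<lambda>v b. b \<and> P v) vs True) (2 * length vs + 1)"
    by (rule foreach_tick) simp
  ultimately show ?thesis by simp
qed

lemma test_min_sep_iff:
  fixes M :: "'v set"
  assumes "\<And>s. test_sep G X Y Z s \<longleftrightarrow> s = sep"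
  defines "A \<equiv> Ant G (X \<union> Y \<union> M)"
  shows "test_min_sep G X Y Z M R b \<longleftrightarrow> b = (Z \<subseteq> A \<and> Z \<subseteq> R \<and> sep \<and>
    Z - M = reached (delete_nodes M (augmented (induced G A))) X Z \<and>
    Z - M = reached (delete_nodes M (augmented (induced G A))) Y Z)"
proof -
  have "(if \<not> p \<or> \<not> q then b = False else \<exists>s. s = sep \<and> (if s = False then b = False
      else if \<not> x then b = False else if \<not> y then b = False else b = True)) \<longleftrightarrow>
      b = (p \<and> q \<and> sep \<and> x \<and> y)" for p q x y
    by (cases p; cases q; cases sep; cases x; cases y) (simp_all add: ex_bool_eq)
  then show ?thesis
    unfolding test_min_sep_def Let_def assms(1) Diff_eq_empty_iff A_def .
qed

text \<open>Rejecting sets outside \<open>A\<close> loses no minimal separator, and inside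
  \<open>A\<close> the reachability criterion applies. The second conclusion stands alone because
  the program evaluates the same conjunction.\<close>

lemma test_min_sep_correct:
  assumes G: "ancestral_graph G" and XY: "X \<subseteq> nodes G" "Y \<subseteq> nodes G"
    and Z: "Z \<subseteq> nodes G - (X \<union> Y)" and M: "M \<subseteq> Z"
  defines "A \<equiv> Ant G (X \<union> Y \<union> M)"
  shows "test_min_sep G X Y Z M R b \<longleftrightarrow> b = (Z \<subseteq> R \<and> minimal_m_separator G M X Y Z)"
    and "Z \<subseteq> R \<and> minimal_m_separator G M X Y Z \<longleftrightarrow> Z \<subseteq> A \<and> Z \<subseteq> R \<and> m_separator G X Y Z \<and>
      Z - M = reached (delete_nodes M (augmented (induced G A))) X Z \<and>
      Z - M = reached (delete_nodes M (augmented (induced G A))) Y Z"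
proof -
  have sub: "X \<subseteq> nodes (induced G A)" "Y \<subseteq> nodes (induced G A)"
    using subset_Ant[OF ancestral_imp_mixed[OF G], of "X \<union> Y"] XY Ant_mono[of "X \<union> Y" "X \<union> Y \<union> M" G]
    unfolding A_def induced_simps by blast+
  have disj: "X \<inter> M = {}" "Y \<inter> M = {}" using M Z by blast+
  note reached = reached_eq[OF ancestral_induced[OF G] sub(1) disj(1) M]
    reached_eq[OF ancestral_induced[OF G] sub(2) disj(2) M]
  show iff: "Z \<subseteq> R \<and> minimal_m_separator G M X Y Z \<longleftrightarrow> Z \<subseteq> A \<and> Z \<subseteq> R \<and> m_separator G X Y Z \<and>
      Z - M = reached (delete_nodes M (augmented (induced G A))) X Z \<and>
      Z - M = reached (delete_nodes M (augmented (induced G A))) Y Z"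
  proof (cases "Z \<subseteq> A \<and> m_separator G X Y Z")
    case True
    then have A: "Z \<subseteq> A" and sep: "m_separator G X Y Z" by blast+
    show ?thesis
      unfolding reached minimal_m_separator_iff[OF G XY Z M A[unfolded A_def] sep, folded A_def]
      by (simp only: A sep simp_thms)
  next
    case False
    then have "\<not> minimal_m_separator G M X Y Z"
      using minimal_m_separator_subset[OF G XY Z M, folded A_def]
      unfolding minimal_m_separator_def by blast
    with False show ?thesis by blast
  qed
  have sep: "test_sep G X Y Z s \<longleftrightarrow> s = m_separator G X Y Z" for s
    using test_sep_iff[OF ancestral_imp_mixed[OF G] XY(1)] m_separator_iff_test_sep[OF G XY Z M] by simp
  show "test_min_sep G X Y Z M R b \<longleftrightarrow> b = (Z \<subseteq> R \<and> minimal_m_separator G M X Y Z)"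
    unfolding iff A_def by (rule test_min_sep_iff[OF sep])
qed

section \<open>Correctness and running time of the program\<close>

context
  fixes G :: "'v mixed_graph" and vs adj
  assumes G: "ancestral_graph G" and adj: "adjacency_lists G vs adj"
begin

abbreviation (input) degrees :: nat where
  "degrees \<equiv> total_degree G adj"

text \<open>An entry of an adjacency list yields at most one \<open>At\<close> and one
  \<open>Via\<close> state: two steps for reading it and two for pushing each state make 6.\<close>

lemma aug_succs_result:
  assumes A: "A \<subseteq> nodes G" and s: "s \<in> At ` A \<union> Via ` A"
  shows "\<exists>ss t. aug_succs adj A Z M s = Result ss t \<and>
    set ss = aug_search_rel (induced G A) Z M `` {s} \<and> set ss \<subseteq> At ` A \<union> Via ` A \<and>
    t + 2 * length ss + 2 \<le> (case s of At v \<Rightarrow> 6 * length (adj v) + 3 | Via v \<Rightarrow> 6 * length (adj v) + 3)"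
proof -
  note mixed = ancestral_imp_mixed[OF G]
  let ?r = "aug_search_rel (induced G A) Z M"
  have joins: "(f, w) \<in> set (adj v) \<longleftrightarrow> joins G v f w" if "v \<in> A" for f v w
    using set_adj[OF mixed adj, of v] A that by auto
  have result: "foreach (adj v) (\<lambda>(f, w) ss. tick (h (f, w) @ ss)) [] =
        Result (fold (\<lambda>x ss. h x @ ss) (adj v) []) (2 * length (adj v) + 1)"
    "2 * length (adj v) + 1 + 2 * length (fold (\<lambda>x ss. h x @ ss) (adj v) []) + 2 \<le> 6 * length (adj v) + 3"
    "set (fold (\<lambda>x ss. h x @ ss) (adj v) []) = (\<Union>x\<in>set (adj v). set (h x))"
    if "\<And>x. length (h x) \<le> 2" for v and h :: "edge_type \<times> 'v \<Rightarrow> 'v search_state list"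
  proof -
    show "foreach (adj v) (\<lambda>(f, w) ss. tick (h (f, w) @ ss)) [] =
        Result (fold (\<lambda>x ss. h x @ ss) (adj v) []) (2 * length (adj v) + 1)"
      by (rule foreach_tick) (auto split: prod.split)
    show "2 * length (adj v) + 1 + 2 * length (fold (\<lambda>x ss. h x @ ss) (adj v) []) + 2 \<le> 6 * length (adj v) + 3"
      using length_fold_append[OF that, where xs = "adj v" and ys = "[]"] by simp
    show "set (fold (\<lambda>x ss. h x @ ss) (adj v) []) = (\<Union>x\<in>set (adj v). set (h x))"
      by (simp only: set_fold_append) simp
  qed
  have sub: "?r `` {s} \<subseteq> At ` A \<union> Via ` A"
  proof
    fix t assume "t \<in> ?r `` {s}"
    then have "aug_step (induced G A) Z M s t" by (simp add: aug_search_rel_def)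
    then show "t \<in> At ` A \<union> Via ` A" by (cases s; cases t) auto
  qed
  show ?thesis
  proof (cases s)
    case (At v)
    then have v: "v \<in> A" using s by auto
    show ?thesis
    proof (cases "v \<in> Z")
      case True
      have "\<not> aug_step (induced G A) Z M (At v) t" for t using True by (cases t) auto
      then have "?r `` {s} = {}" using At by (auto simp: aug_search_rel_def)
      then show ?thesis using At True by (simp add: aug_succs_def tick_def)
    next
      case False
      let ?h = "\<lambda>(f, w). (if w \<in> A \<and> w \<notin> M then [At w] else []) @
          (if w \<in> A \<and> head_at_end f then [Via w] else [])"
      have len: "length (?h x) \<le> 2" for x by (cases x) simp
      have "(\<Union>x\<in>set (adj v). set (?h x)) = ?r `` {s}"
      proof (rule set_eqI)
        fix t
        have "t \<in> (\<Union>x\<in>set (adj v). set (?h x)) \<longleftrightarrow>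
            (\<exists>f w. joins G v f w \<and> w \<in> A \<and> (t = At w \<and> w \<notin> M \<or> t = Via w \<and> head_at_end f))"
          by (auto simp: joins[OF v] Bex_def split: if_splits)
        also have "\<dots> \<longleftrightarrow> (\<exists>w. adjacent G v w \<and> w \<in> A \<and> (t = At w \<and> w \<notin> M \<or> t = Via w \<and> arrowhead G v w))"
          using joins_head(1)[OF G] adjacent_iff_joins[OF G] by metis
        also have "\<dots> \<longleftrightarrow> aug_step (induced G A) Z M (At v) t"
          using False v arrowhead_adjacent[OF mixed] by (cases t) auto
        finally show "t \<in> (\<Union>x\<in>set (adj v). set (?h x)) \<longleftrightarrow> t \<in> ?r `` {s}"
          by (simp add: aug_search_rel_def At)
      qed
      moreover have "aug_succs adj A Z M s = foreach (adj v) (\<lambda>(f, w) ss. tick (?h (f, w) @ ss)) []"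
        using At False by (simp add: aug_succs_def)
      ultimately show ?thesis using result[of ?h v, OF len] sub At by auto
    qed
  next
    case (Via v)
    then have v: "v \<in> A" using s by auto
    let ?h = "\<lambda>(f, w). (if w \<in> A \<and> head_at_start f \<and> w \<notin> M then [At w] else []) @
        (if w \<in> A \<and> f = Bidirected then [Via w] else [])"
    have len: "length (?h x) \<le> 2" for x by (cases x) simp
    have "(\<Union>x\<in>set (adj v). set (?h x)) = ?r `` {s}"
    proof (rule set_eqI)
      fix t
      have "t \<in> (\<Union>x\<in>set (adj v). set (?h x)) \<longleftrightarrow>
          (\<exists>f w. joins G v f w \<and> w \<in> A \<and> (t = At w \<and> head_at_start f \<and> w \<notin> M \<or> t = Via w \<and> f = Bidirected))"
        by (auto simp: joins[OF v] Bex_def split: if_splits)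
      also have "\<dots> \<longleftrightarrow> (\<exists>w. w \<in> A \<and> (t = At w \<and> arrowhead G w v \<and> w \<notin> M \<or> t = Via w \<and> (v, w) \<in> bidir G))"
        using joins_head(2)[OF G] adjacent_iff_joins[OF G] arrowhead_adjacent[OF mixed]
          adjacent_sym[OF mixed] joins.simps(4)[of G v] by metis
      also have "\<dots> \<longleftrightarrow> aug_step (induced G A) Z M (Via v) t"
        using v by (cases t) auto
      finally show "t \<in> (\<Union>x\<in>set (adj v). set (?h x)) \<longleftrightarrow> t \<in> ?r `` {s}"
        by (simp add: aug_search_rel_def Via)
    qed
    moreover have "aug_succs adj A Z M s = foreach (adj v) (\<lambda>(f, w) ss. tick (?h (f, w) @ ss)) []"
      using Via by (simp add: aug_succs_def)
    ultimately show ?thesis using result[of ?h v, OF len] sub Via by auto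
  qed
qed

text \<open>Every node of \<open>A\<close> gives an \<open>At\<close> and a \<open>Via\<close>
  state, which doubles 6 to 12 and 3 to 6; the other 4 steps per node come from the two loops over
  \<open>vs\<close>.\<close>

lemma all_reached_prog_result:
  assumes A: "A \<subseteq> nodes G" and S: "S \<subseteq> A" and M: "M \<subseteq> Z" and Z: "Z \<subseteq> nodes G" "Z \<inter> S = {}"
  shows "\<exists>t. all_reached_prog vs adj A S Z M =
      Result (Z - M = reached (delete_nodes M (augmented (induced G A))) S Z) t \<and>
    t \<le> 12 * degrees + 10 * card (nodes G) + 4"
proof -
  note mixed = ancestral_imp_mixed[OF G]
  note vs = nodes_list[OF mixed adj]
  let ?H = "induced G A"
  let ?r = "aug_search_rel ?H Z M"
  let ?K = "\<lambda>s. case s of At v \<Rightarrow> 6 * length (adj v) + 3 | Via v \<Rightarrow> 6 * length (adj v) + 3"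
  have finA: "finite A" using A finite_nodes[OF mixed adj] by (rule finite_subset)
  obtain P where P: "initial vs (\<lambda>v. v \<in> S) At = Result (P, set P) (2 * length vs + 1)" "distinct P"
    "set P = At ` S"
  proof -
    have eq: "{v \<in> set vs. v \<in> S} = S" using S A vs(2) by blast
    have "inj At" by (simp add: inj_def)
    from initial_result[OF vs(1) this, of "\<lambda>v. v \<in> S", unfolded eq] that show ?thesis by blast
  qed
  have "\<exists>t. search (aug_succs adj A Z M) (P, set P) = Result (?r\<^sup>* `` set P) t \<and>
      t \<le> sum ?K (At ` A \<union> Via ` A) + 2"
  proof (rule search_result)
    show "finite (At ` A \<union> Via ` A)" using finA by simp
    show "set P \<subseteq> At ` A \<union> Via ` A" unfolding P(3) using S by blast
  qed (rule P(2), rule aug_succs_result[OF A])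
  then obtain t where t: "search (aug_succs adj A Z M) (P, set P) = Result (?r\<^sup>* `` set P) t"
    "t \<le> sum ?K (At ` A \<union> Via ` A) + 2" by blast
  have "sum ?K (At ` A \<union> Via ` A) = sum ?K (At ` A) + sum ?K (Via ` A)"
    using finA by (intro sum.union_disjoint) auto
  also have "\<dots> = 2 * (\<Sum>v\<in>A. 6 * length (adj v) + 3)"
    by (simp add: sum.reindex inj_on_def)
  also have "\<dots> \<le> 2 * (\<Sum>v\<in>nodes G. 6 * length (adj v) + 3)"
    using A finite_nodes[OF mixed adj] by (intro mult_le_mono2 sum_mono2) auto
  also have "\<dots> = 12 * degrees + 6 * card (nodes G)"
    unfolding sum_affine_length[OF mixed adj] by simp
  finally have bound: "t \<le> 12 * degrees + 6 * card (nodes G) + 2" using t(2) by simp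
  have reached: "reached (delete_nodes M (augmented ?H)) S Z = {v \<in> Z. At v \<in> ?r\<^sup>* `` set P}"
  proof -
    have "S \<subseteq> nodes ?H" unfolding induced_simps using S A by blast
    moreover have "S \<inter> M = {}" using M Z by blast
    ultimately have "reached (delete_nodes M (augmented ?H)) S Z = {v \<in> Z. \<exists>x\<in>S. (At x, At v) \<in> ?r\<^sup>*}"
      unfolding aug_search_rel_iff[OF mixed_induced[OF mixed]]
      by (rule reached_eq[OF ancestral_induced[OF G] _ _ M])
    also have "\<dots> = {v \<in> Z. At v \<in> ?r\<^sup>* `` set P}" unfolding P(3) by blast
    finally show ?thesis .
  qed
  have val: "(\<forall>v\<in>set vs. (v \<in> Z \<and> v \<notin> M) = (v \<in> Z \<and> At v \<in> ?r\<^sup>* `` set P)) \<longleftrightarrow>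
      Z - M = reached (delete_nodes M (augmented ?H)) S Z"
    unfolding reached vs(2) set_eq_iff using Z(1) by blast
  have "all_reached_prog vs adj A S Z M = Result (Z - M = reached (delete_nodes M (augmented ?H)) S Z)
      (2 * card (nodes G) + 1 + (t + (2 * card (nodes G) + 1)))"
    by (simp only: all_reached_prog_def P(1) t(1) foreach_conj val bind_timed.simps timed.case vs(3))
  with bound show ?thesis by simp
qed

text \<open>\<open>36 = 4 + 8 + 12 + 12\<close> adds up the anterior search, TestSep and the two
  searches in the augmented graph; \<open>41 = 5 + 14 + 10 + 10 + 2\<close> also contains the loop
  that checks \<open>Z\<close>.\<close>

lemma test_min_sep_prog_correct:
  assumes XY: "X \<subseteq> nodes G" "Y \<subseteq> nodes G" and Z: "Z \<subseteq> nodes G - (X \<union> Y)" and M: "M \<subseteq> Z"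
  shows "\<exists>t. test_min_sep_prog vs adj X Y Z M R = Result (Z \<subseteq> R \<and> minimal_m_separator G M X Y Z) t \<and>
    t \<le> 36 * degrees + 41 * card (nodes G) + 16"
proof -
  note mixed = ancestral_imp_mixed[OF G]
  note vs = nodes_list[OF mixed adj]
  let ?A = "Ant G (X \<union> Y \<union> M)"
  let ?H = "induced G ?A"
  have sub: "X \<union> Y \<union> M \<subseteq> nodes G" using XY Z M by blast
  then have A: "{u. \<exists>w. (w \<in> X \<or> w \<in> Y \<or> w \<in> M) \<and> (u, w) \<in> (dir G \<union> undir G)\<^sup>*} = ?A"
  proof -
    \<comment> \<open>The closure in the result of the program is not restricted to nodes, but a
      walk ending in a node also starts in one.\<close>
    have "u \<in> nodes G" if "(u, w) \<in> (dir G \<union> undir G)\<^sup>*" "w \<in> nodes G" for u w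
      using that mixed by (cases rule: converse_rtranclE) (auto simp: mixed_graph_def)
    then show ?thesis using sub unfolding set_eq_iff Ant_iff[OF mixed] by blast
  qed
  have "\<exists>t. anteriors_prog vs adj (\<lambda>v. v \<in> X \<or> v \<in> Y \<or> v \<in> M) = Result ?A t \<and>
      t \<le> 4 * degrees + 5 * card (nodes G) + 3"
    unfolding A[symmetric] by (rule anteriors_prog_result[OF mixed adj]) (use sub in blast)
  then obtain t1 where t1: "anteriors_prog vs adj (\<lambda>v. v \<in> X \<or> v \<in> Y \<or> v \<in> M) = Result ?A t1"
    "t1 \<le> 4 * degrees + 5 * card (nodes G) + 3" by blast
  have "\<exists>t. test_sep_prog vs adj X Y Z = Result (m_separator G X Y Z) t \<and>
      t \<le> 8 * degrees + 14 * card (nodes G) + 3"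
    unfolding m_separator_iff_test_sep[OF G XY(1,2) Z M] by (rule test_sep_prog_result[OF mixed adj XY(1)])
  then obtain t2 where t2: "test_sep_prog vs adj X Y Z = Result (m_separator G X Y Z) t2"
    "t2 \<le> 8 * degrees + 14 * card (nodes G) + 3" by blast
  have AG: "?A \<subseteq> nodes G" by (rule Ant_subset_nodes[OF mixed])
  have XYA: "X \<subseteq> ?A" "Y \<subseteq> ?A" using subset_Ant[OF mixed sub] by blast+
  have Z': "Z \<subseteq> nodes G" "Z \<inter> X = {}" "Z \<inter> Y = {}" using Z by blast+
  let ?reached = "\<lambda>S. Z - M = reached (delete_nodes M (augmented ?H)) S Z"
  obtain t3 where t3: "all_reached_prog vs adj ?A X Z M = Result (?reached X) t3"
    "t3 \<le> 12 * degrees + 10 * card (nodes G) + 4"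
    using all_reached_prog_result[OF AG XYA(1) M Z'(1,2)] by blast
  obtain t4 where t4: "all_reached_prog vs adj ?A Y Z M = Result (?reached Y) t4"
    "t4 \<le> 12 * degrees + 10 * card (nodes G) + 4"
    using all_reached_prog_result[OF AG XYA(2) M Z'(1,3)] by blast
  define p where "p \<longleftrightarrow> Z \<subseteq> ?A \<and> Z \<subseteq> R"
  have "(\<forall>v\<in>set vs. v \<in> Z \<longrightarrow> v \<in> ?A \<and> v \<in> R) \<longleftrightarrow> p"
    unfolding p_def using Z'(1) vs(2) by blast
  then have ok: "foreach vs (\<lambda>v b. tick (b \<and> (v \<in> Z \<longrightarrow> v \<in> ?A \<and> v \<in> R))) True =
      Result p (2 * card (nodes G) + 1)"
    by (simp only: foreach_conj vs(3))
  define s where "s \<longleftrightarrow> m_separator G X Y Z"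
  define rx where "rx \<longleftrightarrow> ?reached X"
  define ry where "ry \<longleftrightarrow> ?reached Y"
  have iff: "(Z \<subseteq> R \<and> minimal_m_separator G M X Y Z) \<longleftrightarrow> p \<and> s \<and> rx \<and> ry"
    unfolding test_min_sep_correct(2)[OF G XY Z M] p_def s_def rx_def ry_def conj_assoc ..
  \<comment> \<open>An early exit replaces the remaining phases by a single step, hence the final
    \<open>+ 1\<close>.\<close>
  have "\<exists>t. test_min_sep_prog vs adj X Y Z M R = Result (p \<and> s \<and> rx \<and> ry) t \<and>
      t \<le> t1 + (2 * card (nodes G) + 1) + t2 + t3 + t4 + 1"
    unfolding test_min_sep_prog_def t1(1) t2(1) t3(1) t4(1) bind_timed.simps ok
    unfolding tick_def s_def[symmetric] rx_def[symmetric] ry_def[symmetric]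
    by (cases p; cases s; cases rx) simp_all
  then obtain t where t: "test_min_sep_prog vs adj X Y Z M R = Result (p \<and> s \<and> rx \<and> ry) t"
    "t \<le> t1 + (2 * card (nodes G) + 1) + t2 + t3 + t4 + 1" by blast
  have "t \<le> 36 * degrees + 41 * card (nodes G) + 16"
    using t(2) t1(2) t2(2) t3(2) t4(2) by linarith
  with t(1) show ?thesis unfolding iff by blast
qed

end

section \<open>Bounds in terms of nodes and edges\<close>

lemma card_edges_le:
  assumes "mixed_graph G"
  shows "card (edges G) \<le> (card (nodes G))\<^sup>2"
proof -
  have fin: "finite (nodes G)" using assms by (simp add: mixed_graph_def)
  have "edges G \<subseteq> (\<lambda>(u, v). {u, v}) ` (nodes G \<times> nodes G)"
    using adjacent_nodes[OF assms] unfolding edges_def by blast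
  then have "card (edges G) \<le> card (nodes G \<times> nodes G)"
    using fin by (intro surj_card_le) auto
  then show ?thesis by (simp add: card_cartesian_product power2_eq_square)
qed

lemma card_augmented_le:
  assumes "finite N" "nodes H \<subseteq> N"
  shows "card (snd (augmented H)) \<le> (card N)\<^sup>2"
proof -
  have "snd (augmented H) \<subseteq> (\<lambda>(u, v). {u, v}) ` (N \<times> N)"
  proof
    fix e assume "e \<in> snd (augmented H)"
    then obtain p where p: "path H p" "e = {hd p, last p}" unfolding augmented_def by auto
    then have "p \<noteq> []" "set p \<subseteq> N" using assms(2) unfolding path_def by blast+
    then have "hd p \<in> N" "last p \<in> N" using hd_in_set last_in_set by blast+
    then show "e \<in> (\<lambda>(u, v). {u, v}) ` (N \<times> N)" unfolding p(2) by blast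
  qed
  then have "card (snd (augmented H)) \<le> card (N \<times> N)"
    using assms(1) by (intro surj_card_le) auto
  then show ?thesis by (simp add: card_cartesian_product power2_eq_square)
qed

text \<open>\<open>288 = 36 * 8\<close> stems from the degree sum and absorbs
  \<open>41 + 16\<close>, as \<open>X\<close> provides a node. Nodes and edges are each at most the
  square of the number of nodes, which doubles it to 576. The summand \<open>k\<close> leaves room
  for the number of augmented edges, for \<open>M = I\<close> as well as for
  \<open>M = {}\<close>.\<close>

lemma test_min_sep_prog_time:
  fixes G :: "'v mixed_graph"
  assumes G: "ancestral_graph G" and adj: "adjacency_lists G vs adj"
    and XY: "X \<subseteq> nodes G" "Y \<subseteq> nodes G" "X \<noteq> {}" and Z: "Z \<subseteq> nodes G - (X \<union> Y)" and M: "M \<subseteq> Z"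
  shows "\<exists>t. test_min_sep_prog vs adj X Y Z M R = Result (Z \<subseteq> R \<and> minimal_m_separator G M X Y Z) t \<and>
    t \<le> 576 * (card (nodes G) + card (edges G) + k) \<and> t \<le> 576 * (card (nodes G))\<^sup>2"
proof -
  note mixed = ancestral_imp_mixed[OF G]
  let ?n = "card (nodes G)" and ?m = "card (edges G)"
  obtain t where t: "test_min_sep_prog vs adj X Y Z M R = Result (Z \<subseteq> R \<and> minimal_m_separator G M X Y Z) t"
    "t \<le> 36 * total_degree G adj + 41 * ?n + 16"
    using test_min_sep_prog_correct[OF G adj XY(1,2) Z M] by blast
  have "0 < ?n" using finite_nodes[OF mixed adj] XY by (auto simp: card_gt_0_iff)
  then have le: "t \<le> 288 * (?n + ?m)" using t(2) total_degree_le[OF mixed adj] by (simp add: algebra_simps)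
  moreover have "?n \<le> ?n\<^sup>2" by (simp add: power2_eq_square)
  ultimately have "t \<le> 576 * ?n\<^sup>2" using card_edges_le[OF mixed] by (simp add: algebra_simps)
  moreover have "t \<le> 576 * (?n + ?m + k)" using le by (simp add: algebra_simps)
  ultimately show ?thesis using t(1) by blast
qed

text \<open>The size \<open>n + m\<close> of the input stands beside \<open>m\<^sub>a\<close>
  because edges of \<open>G\<close> outside the anterior set are read as well, although they are not
  counted by \<open>m\<^sub>a\<close>. The constant is chosen before the graph.\<close>

theorem proposition3:
  shows "\<exists>C :: nat. \<forall>(G :: 'v mixed_graph) X Y Z I R vs adj.
    ancestral_graph G \<and> X \<subseteq> nodes G \<and> Y \<subseteq> nodes G \<and> X \<inter> Y = {} \<and> X \<noteq> {} \<and> Y \<noteq> {} \<and>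
    R \<subseteq> nodes G \<and> R \<inter> (X \<union> Y) = {} \<and> I \<subseteq> Z \<and> Z \<subseteq> nodes G - (X \<union> Y) \<and>
    adjacency_lists G vs adj \<longrightarrow>
    (let n = card (nodes G);
         m = card (edges G);
         m\<^sub>a = card (snd (augmented (induced G (Ant G (X \<union> Y \<union> I)))))
     in
       (\<forall>b. test_min_sep G X Y Z I R b \<longleftrightarrow> b = (Z \<subseteq> R \<and> minimal_m_separator G I X Y Z)) \<and>
       (\<forall>b. test_min_sep G X Y Z {} R b \<longleftrightarrow> b = (Z \<subseteq> R \<and> strongly_minimal_m_separator G X Y Z)) \<and>
       (\<exists>t. test_min_sep_prog vs adj X Y Z I R
              = Result (Z \<subseteq> R \<and> minimal_m_separator G I X Y Z) t \<and>
            t \<le> C * (n + m + m\<^sub>a) \<and> t \<le> C * n\<^sup>2) \<and>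
       (\<exists>t. test_min_sep_prog vs adj X Y Z {} R
              = Result (Z \<subseteq> R \<and> strongly_minimal_m_separator G X Y Z) t \<and>
            t \<le> C * (n + m + m\<^sub>a) \<and> t \<le> C * n\<^sup>2) \<and>
       m\<^sub>a \<le> n\<^sup>2)"
proof (intro exI[of _ 576] allI impI, elim conjE)
  fix G :: "'v mixed_graph" and X Y Z I R vs adj
  assume G: "ancestral_graph G" and XY: "X \<subseteq> nodes G" "Y \<subseteq> nodes G" "X \<noteq> {}"
    and I: "I \<subseteq> Z" and Z: "Z \<subseteq> nodes G - (X \<union> Y)" and adj: "adjacency_lists G vs adj"
  have "card (snd (augmented (induced G (Ant G (X \<union> Y \<union> I))))) \<le> (card (nodes G))\<^sup>2"
    by (rule card_augmented_le) (use finite_nodes[OF ancestral_imp_mixed[OF G] adj] in auto)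
  then show "let n = card (nodes G);
         m = card (edges G);
         m\<^sub>a = card (snd (augmented (induced G (Ant G (X \<union> Y \<union> I)))))
     in
       (\<forall>b. test_min_sep G X Y Z I R b \<longleftrightarrow> b = (Z \<subseteq> R \<and> minimal_m_separator G I X Y Z)) \<and>
       (\<forall>b. test_min_sep G X Y Z {} R b \<longleftrightarrow> b = (Z \<subseteq> R \<and> strongly_minimal_m_separator G X Y Z)) \<and>
       (\<exists>t. test_min_sep_prog vs adj X Y Z I R
              = Result (Z \<subseteq> R \<and> minimal_m_separator G I X Y Z) t \<and>
            t \<le> 576 * (n + m + m\<^sub>a) \<and> t \<le> 576 * n\<^sup>2) \<and>
       (\<exists>t. test_min_sep_prog vs adj X Y Z {} R
              = Result (Z \<subseteq> R \<and> strongly_minimal_m_separator G X Y Z) t \<and>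
            t \<le> 576 * (n + m + m\<^sub>a) \<and> t \<le> 576 * n\<^sup>2) \<and>
       m\<^sub>a \<le> n\<^sup>2"
    unfolding Let_def
    by (intro conjI allI test_min_sep_correct(1)[OF G XY(1,2) Z] test_min_sep_prog_time[OF G adj XY Z] I empty_subsetI)
qed

end
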